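(* Let $\mathcal{R}$ be the behavior of a system $\dot x=f(x,u)$, $y=h(x)$ (with state set $\mathcal{X}$, input-value space $\mathcal{U}$ and output-value space $\mathcal{Y}$, satisfying the standing assumptions in the context). Suppose there is some $\gamma\in\mathcal{K}_\infty$ such that, for each compact subset $U\subseteq\mathcal{U}$, there exists a $U$-decrease function $V_U$ with $$|h(Z_{V_U})|\leq\gamma(|U|).$$ Then, for each compact subset $U\subseteq\mathcal{U}$: 1. if $(\omega,\eta)\in\mathcal{R}$ is such that $\omega\to U$, then $\eta\to h(Z_{V_U})$; 2. $\mathcal{R}$ has Cauchy gain $\gamma$ on $U$ and incremental limit gain $\gamma$ on $U$. In particular, $\mathcal{R}$ has Cauchy gain $\gamma$ and incremental limit gain $\gamma$.
   Context: Notation: $\mathbb{R}_{\geq 0}=[0,+\infty)$; in any metric space $M$ the distance between $a$ and $b$ is written $|a-b|$, and $|U|=\sup\{|u-v| : u,v\in U\}$ denotes the diameter of a subset $U$. A function $\omega:\mathbb{R}_{\geq 0}\to M$ is precompact if there is a compact $K\subseteq M$ with $\omega(t)\in K$ for all $t\geq 0$. For $U\subseteq M$, "$\omega\to U$" means: for every $\varepsilon>0$ there is $T\geq 0$ such that $\omega(t)\in B_\varepsilon(U)=\{u\in M : \exists u'\in U,\ |u-u'|\leq\varepsilon\}$ for all $t\geq T$. $\mathcal{K}_\infty$ is the class of continuous, strictly increasing, unbounded functions $\gamma:\mathbb{R}_{\geq 0}\to\mathbb{R}_{\geq 0}$ with $\gamma(0)=0$. The asymptotic amplitude of $\omega:\mathbb{R}_{\geq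 0}\to M$ is $$\|\omega\|_{\mathrm{aa}} := \limsup_{s,t\to\infty}|\omega(t)-\omega(s)| = \lim_{T\to\infty}\Big(\sup_{t,s\geq T}|\omega(t)-\omega(s)|\Big)\in[0,\infty].$$ If $\lim_{t\to\infty}\omega(t)$ exists (equivalently, for complete $M$, $\|\omega\|_{\mathrm{aa}}=0$) it is denoted $\omega^\infty$. A behavior with input-value space $\mathcal{U}$ and output-value space $\mathcal{Y}$ (complete metric spaces) is a relation $\mathcal{R}$ between functions $\mathbb{R}_{\geq 0}\to\mathcal{U}$ and functions $\mathbb{R}_{\geq 0}\to\mathcal{Y}$. For $U_0\subseteq\mathcal{U}$: $\mathcal{R}$ has Cauchy gain $\gamma\in\mathcal{K}_\infty$ on $U_0$ if $\|\eta\|_{\mathrm{aa}}\leq\gamma(\|\omega\|_{\mathrm{aa}})$ for each $(\omega,\eta)\in\mathcal{R}$ with $\omega\to U_0$; $\mathcal{R}$ has incremental limit gain $\kappa\in\mathcal{K}_\infty$ on $U_0$ if $\limsup_{t\to\infty}|\eta_1(t)-\eta_2(t)|\leq\kappa(|\omega_1^\infty-\omega_2^\infty|)$ whenever $(\omega_1,\eta_1),(\omega_2,\eta_2)\in\mathcal{R}$ are such that $\omega_1^\infty$ and $\omega_2^\infty$ both exist and belong to $U_0$. "Cauchy gain" and "incremental limit gain" without "on $U_0$" mean the case $U_0=\mathcal{U}$. Systems. Consider $\dot x=f(x,u)$, $y=h(x)$, with states in a subset $\mathcal{X}\subseteq\mathbb{R}^n$ and with $\mathcal{U},\mathcal{Y}$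 complete metric spaces. Standing assumptions: $f:\mathcal{X}_0\times\mathcal{U}\to\mathbb{R}^n$ is defined on an open set $\mathcal{X}_0\subseteq\mathbb{R}^n$ containing $\mathcal{X}$, is continuous, and is locally Lipschitz in $x$ uniformly on compact subsets of $\mathcal{X}_0\times\mathcal{U}$; $h:\mathcal{X}\to\mathcal{Y}$ is continuous; $\mathcal{X}$ is invariant and forward complete: for each Lebesgue-measurable precompact input $\omega:\mathbb{R}_{\geq 0}\to\mathcal{U}$ and each $x_0\in\mathcal{X}$, the unique solution $\xi(t)=\varphi(t,x_0,\omega)$ of $\dot\xi(t)=f(\xi(t),\omega(t))$ (for almost all $t$), $\xi(0)=x_0$, is defined and satisfies $\xi(t)\in\mathcal{X}$ for all $t\geq 0$. The behavior of the system is the relation $\mathcal{R}$ with $(\omega,\eta)\in\mathcal{R}$ if and only if $\omega:\mathbb{R}_{\geq 0}\to\mathcal{U}$ is precompact and Lebesgue-measurable and there exists $x_0\in\mathcal{X}$ such that $\eta(t)=h(\varphi(t,x_0,\omega))$ for all $t\geq 0$. (Measurable functions being equivalence classes modulo null sets, limsups, convergence and precompactness of inputs are understood in the almost-everywhere sense.) Decrease functions. Given $U\subseteq\mathcal{U}$, a $U$-decrease function is a function $V:\mathcal{X}\to\mathbb{R}_{\geq 0}$ such that: (i) $V$ is proper, i.e. $\{x\in\mathcal{X} : a\leq V(x)\leq b\}$ is compact for each $a\leq b$ in $\mathbb{R}_{\geq 0}$; (ii) $V$ is continuous; (iii) for each $x\in\mathcal{X}$ not belonging to $Z_V:=\{x\in\mathcal{X}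 : V(x)=0\}$, $V$ is continuously differentiable in a neighborhood of $x$ (meaning that $V$ extends to a $C^1$ function on a neighborhood of $x$ in $\mathcal{X}_0$) and $\nabla V(x)\cdot f(x,u)<0$ for all $u\in U$. *)

theory Defs
  imports "HOL-Analysis.Analysis"
begin

text \<open>
  Functions on the nonnegative reals are represented by functions on \<^typ>\<open>real\<close> of which
  only the values at nonnegative arguments matter.
\<close>

definition K_infinity :: "(real \<Rightarrow> real) \<Rightarrow> bool" where
  "K_infinity \<gamma> \<longleftrightarrow> continuous_on {0..} \<gamma> \<and> strict_mono_on {0..} \<gamma> \<and> \<gamma> 0 = 0 \<and>
     \<not> bdd_above (\<gamma> ` {0..})"

definition gain_ext :: "(real \<Rightarrow> real) \<Rightarrow> ennreal \<Rightarrow> ennreal" where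
  "gain_ext \<gamma> a = (if a = \<infinity> then \<infinity> else ennreal (\<gamma> (enn2real a)))"


text \<open>
  Inputs are determined only up to null sets, so their behaviour at infinity is taken along
  the following filter instead of \<^const>\<open>at_top\<close>.  Outputs are honest functions (continuous,
  in the case of systems) and are treated pointwise, along \<^const>\<open>at_top\<close>.
\<close>

definition ess_at_top :: "real filter" where
  "ess_at_top = inf at_top (ae_filter lebesgue)"

lemma eventually_ess_at_top:
  "eventually P ess_at_top \<longleftrightarrow> (\<exists>T\<ge>0. AE t in lebesgue. t \<ge> T \<longrightarrow> P t)"
proof
  assume "eventually P ess_at_top"
  then obtain Q R where Q: "eventually Q at_top" and R: "AE t in lebesgue. R t"
    and P: "\<And>t. Q t \<Longrightarrow> R t \<Longrightarrow> P t"
    unfolding ess_at_top_def eventually_inf by auto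
  obtain N where N: "\<And>t. t \<ge> N \<Longrightarrow> Q t"
    using Q unfolding eventually_at_top_linorder by auto
  have "AE t in lebesgue. t \<ge> max 0 N \<longrightarrow> P t"
    using R by eventually_elim (auto intro: P N)
  then show "\<exists>T\<ge>0. AE t in lebesgue. t \<ge> T \<longrightarrow> P t"
    by (intro exI[of _ "max 0 N"]) auto
next
  assume "\<exists>T\<ge>0. AE t in lebesgue. t \<ge> T \<longrightarrow> P t"
  then obtain T where T: "AE t in lebesgue. t \<ge> T \<longrightarrow> P t" by auto
  show "eventually P ess_at_top"
    unfolding ess_at_top_def eventually_inf
    by (intro exI[of _ "\<lambda>t. t \<ge> T"] exI[of _ "\<lambda>t. t \<ge> T \<longrightarrow> P t"])
      (use T in \<open>auto simp: eventually_ge_at_top\<close>)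
qed

definition asymptotic_amplitude :: "real filter \<Rightarrow> (real \<Rightarrow> 'a::metric_space) \<Rightarrow> ennreal" where
  "asymptotic_amplitude F \<omega> = Limsup (F \<times>\<^sub>F F) (\<lambda>(t, s). ennreal (dist (\<omega> t) (\<omega> s)))"

definition approaches :: "real filter \<Rightarrow> (real \<Rightarrow> 'a::metric_space) \<Rightarrow> 'a set \<Rightarrow> bool" where
  "approaches F \<omega> U \<longleftrightarrow> (\<forall>\<epsilon>>0. \<forall>\<^sub>F t in F. \<exists>u\<in>U. dist (\<omega> t) u \<le> \<epsilon>)"

definition ess_precompact :: "(real \<Rightarrow> 'a::metric_space) \<Rightarrow> bool" where
  "ess_precompact \<omega> \<longleftrightarrow> (\<exists>K. compact K \<and> (AE t in lebesgue. t \<ge> 0 \<longrightarrow> \<omega> t \<in> K))"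


type_synonym ('u, 'y) behavior = "((real \<Rightarrow> 'u) \<times> (real \<Rightarrow> 'y)) set"

definition cauchy_gain_on ::
    "'u::metric_space set \<Rightarrow> (real \<Rightarrow> real) \<Rightarrow> ('u, 'y::metric_space) behavior \<Rightarrow> bool" where
  "cauchy_gain_on U0 \<gamma> R \<longleftrightarrow> K_infinity \<gamma> \<and>
     (\<forall>(\<omega>, \<eta>)\<in>R. approaches ess_at_top \<omega> U0 \<longrightarrow>
        asymptotic_amplitude at_top \<eta> \<le> gain_ext \<gamma> (asymptotic_amplitude ess_at_top \<omega>))"

definition incremental_limit_gain_on ::
    "'u::metric_space set \<Rightarrow> (real \<Rightarrow> real) \<Rightarrow> ('u, 'y::metric_space) behavior \<Rightarrow> bool" where
  "incremental_limit_gain_on U0 \<kappa> R \<longleftrightarrow> K_infinity \<kappa> \<and>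
     (\<forall>(\<omega>1, \<eta>1)\<in>R. \<forall>(\<omega>2, \<eta>2)\<in>R. \<forall>l1\<in>U0. \<forall>l2\<in>U0.
        (\<omega>1 \<longlongrightarrow> l1) ess_at_top \<longrightarrow> (\<omega>2 \<longlongrightarrow> l2) ess_at_top \<longrightarrow>
        Limsup at_top (\<lambda>t. ennreal (dist (\<eta>1 t) (\<eta>2 t))) \<le> ennreal (\<kappa> (dist l1 l2)))"

abbreviation cauchy_gain ::
    "(real \<Rightarrow> real) \<Rightarrow> ('u::metric_space, 'y::metric_space) behavior \<Rightarrow> bool" where
  "cauchy_gain \<equiv> cauchy_gain_on UNIV"

abbreviation incremental_limit_gain ::
    "(real \<Rightarrow> real) \<Rightarrow> ('u::metric_space, 'y::metric_space) behavior \<Rightarrow> bool" where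
  "incremental_limit_gain \<equiv> incremental_limit_gain_on UNIV"


text \<open>
  A finite family of non-overlapping compact subintervals of \<open>S\<close> is a division of its union.
\<close>

definition abs_continuous_fun_on :: "real set \<Rightarrow> (real \<Rightarrow> 'a::real_normed_vector) \<Rightarrow> bool" where
  "abs_continuous_fun_on S \<xi> \<longleftrightarrow>
     (\<forall>\<epsilon>>0. \<exists>\<delta>>0. \<forall>D. D division_of \<Union>D \<and> \<Union>D \<subseteq> S \<and> (\<Sum>I\<in>D. Sup I - Inf I) < \<delta> \<longrightarrow>
        (\<Sum>I\<in>D. norm (\<xi> (Sup I) - \<xi> (Inf I))) < \<epsilon>)"

text \<open>Global forward (Caratheodory) solutions of \<open>\<xi>' = f(\<xi>, \<omega>)\<close>, \<open>\<xi>(0) = x0\<close>.\<close>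

definition is_solution ::
    "(real^'n \<Rightarrow> 'u \<Rightarrow> real^'n) \<Rightarrow> (real^'n) set \<Rightarrow> (real \<Rightarrow> 'u) \<Rightarrow> real^'n \<Rightarrow> (real \<Rightarrow> real^'n) \<Rightarrow> bool"
  where
  "is_solution f X0 \<omega> x0 \<xi> \<longleftrightarrow>
     \<xi> 0 = x0 \<and> (\<forall>t\<ge>0. \<xi> t \<in> X0) \<and> (\<forall>T\<ge>0. abs_continuous_fun_on {0..T} \<xi>) \<and>
     (AE t in lebesgue. t \<ge> 0 \<longrightarrow> (\<xi> has_vector_derivative f (\<xi> t) (\<omega> t)) (at t))"

definition admissible_input :: "(real \<Rightarrow> 'u::metric_space) \<Rightarrow> bool" where
  "admissible_input \<omega> \<longleftrightarrow> \<omega> \<in> borel_measurable (lebesgue_on {0..}) \<and> ess_precompact \<omega>"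

text \<open>
  Uniqueness of solutions follows from the Lipschitz assumption; accordingly, invariance is
  expressed by saying that any solution starting in \<open>X\<close> stays in \<open>X\<close>.
\<close>

locale control_system =
  fixes f :: "real^'n \<Rightarrow> 'u::complete_space \<Rightarrow> real^'n"
    and h :: "real^'n \<Rightarrow> 'y::complete_space"
    and X0 X :: "(real^'n) set"
  assumes open_X0: "open X0"
    and X_subset: "X \<subseteq> X0"
    and f_continuous: "continuous_on (X0 \<times> UNIV) (\<lambda>(x, u). f x u)"
    and f_lipschitz: "\<And>C. compact C \<Longrightarrow> C \<subseteq> X0 \<times> UNIV \<Longrightarrow>
           \<exists>L. \<forall>u. L-lipschitz_on {x. (x, u) \<in> C} (\<lambda>x. f x u)"
    and h_continuous: "continuous_on X h"
    and forward_complete: "\<And>\<omega> x0. admissible_input \<omega> \<Longrightarrow> x0 \<in> X \<Longrightarrow>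
           \<exists>\<xi>. is_solution f X0 \<omega> x0 \<xi>"
    and invariant: "\<And>\<omega> x0 \<xi>. admissible_input \<omega> \<Longrightarrow> x0 \<in> X \<Longrightarrow>
           is_solution f X0 \<omega> x0 \<xi> \<Longrightarrow> (\<forall>t\<ge>0. \<xi> t \<in> X)"

definition system_behavior ::
    "(real^'n \<Rightarrow> 'u \<Rightarrow> real^'n) \<Rightarrow> (real^'n \<Rightarrow> 'y) \<Rightarrow> (real^'n) set \<Rightarrow> (real^'n) set \<Rightarrow>
     ('u::complete_space, 'y::complete_space) behavior" where
  "system_behavior f h X0 X =
     {(\<omega>, \<eta>). admissible_input \<omega> \<and>
        (\<exists>x0\<in>X. \<exists>\<xi>. is_solution f X0 \<omega> x0 \<xi> \<and> (\<forall>t\<ge>0. \<eta> t = h (\<xi> t)))}"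


definition zero_set :: "(real^'n) set \<Rightarrow> (real^'n \<Rightarrow> real) \<Rightarrow> (real^'n) set" where
  "zero_set X V = {x\<in>X. V x = 0}"

text \<open>
  In the last clause \<open>V'\<close> is the local \<open>C\<^sup>1\<close> extension and \<open>G\<close> its gradient.  For a control system
  the sign condition does not depend on the extension: by invariance, the solution from \<open>x\<close>
  with constant input \<open>u\<close> is a curve in \<open>X\<close> with initial velocity \<open>f x u\<close>, so \<open>V\<close> on \<open>X\<close> alone
  determines \<open>G x \<bullet> f x u\<close>.
\<close>

definition decrease_function ::
    "(real^'n \<Rightarrow> 'u \<Rightarrow> real^'n) \<Rightarrow> (real^'n) set \<Rightarrow> (real^'n) set \<Rightarrow> 'u set \<Rightarrow> (real^'n \<Rightarrow> real) \<Rightarrow> bool"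
  where
  "decrease_function f X0 X U V \<longleftrightarrow>
     (\<forall>x\<in>X. 0 \<le> V x) \<and>
     (\<forall>a b. 0 \<le> a \<longrightarrow> a \<le> b \<longrightarrow> compact {x\<in>X. a \<le> V x \<and> V x \<le> b}) \<and>
     continuous_on X V \<and>
     (\<forall>x\<in>X - zero_set X V. \<exists>W V' G. open W \<and> x \<in> W \<and> W \<subseteq> X0 \<and>
        (\<forall>y\<in>W \<inter> X. V' y = V y) \<and>
        (\<forall>y\<in>W. GDERIV V' y :> G y) \<and> continuous_on W G \<and>
        (\<forall>u\<in>U. G x \<bullet> f x u < 0))"

end

theory Submission
  imports Defs
begin

text \<open>
  The heart of the matter is that the output approaches \<open>h ` zero_set X (V U)\<close> whenever the input
  approaches the compact set \<open>U\<close> (\<open>output_approaches_image_zero_set\<close>). Both gains are then obtained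
  by choosing \<open>U\<close> as small as possible. For the Cauchy gain, \<open>U\<close> is the set of essential cluster
  values of the input, whose diameter is at most the asymptotic amplitude of the input
  (\<open>diameter_cluster_values_le\<close>); the amplitude of the output is at most the diameter of the set that
  the output approaches, hence at most \<open>\<gamma> (diameter U)\<close>. For the incremental limit gain, \<open>U\<close> consists
  of the limits of the two inputs.

  The convergence of the output is a Lyapunov argument in two stages. The decrease function for \<open>U\<close>
  decreases only while the input is sufficiently close to \<open>U\<close>, and how close depends on the part of the
  state space that the solution visits; so it has to be known first that the solution is bounded.
  Boundedness comes from a second decrease function, the one for a compact set \<open>K\<close> that contains
  the values of the input at almost all times: it never exceeds its initial value
  (\<open>decrease_function_le_initial\<close>), and it is proper. On the resulting compact set, each layer
  \<open>a \<le> V \<le> b\<close> with \<open>a > 0\<close> of the decrease function for \<open>U\<close> admits a uniform decay rate for all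
  inputs in a neighbourhood of \<open>U\<close> (\<open>decrease_function_level_set\<close>). As the decrease function is
  nonnegative, it must fall below \<open>a\<close>, and it stays there
  (\<open>decrease_function_vanishes_at_infinity\<close>).

  Solutions are absolutely continuous and satisfy the differential equation almost everywhere only.
  Integrating the decay rate therefore rests on \<open>decrease_of_AE_derivative_le\<close>, which is proved with
  a gauge on the time interval.
\<close>

section \<open>Absolutely continuous functions and their derivatives\<close>

lemma abs_continuous_fun_on_imp_continuous_on:
  assumes "abs_continuous_fun_on {a..b} \<xi>"
  shows "continuous_on {a..b} \<xi>"
  unfolding continuous_on_iff
proof (intro ballI allI impI)
  fix t and e :: real assume t: "t \<in> {a..b}" and "e > 0"
  obtain d where d: "d > 0" and small: "\<And>D. D division_of \<Union>D \<Longrightarrow> \<Union>D \<subseteq> {a..b} \<Longrightarrow>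
      (\<Sum>I\<in>D. Sup I - Inf I) < d \<Longrightarrow> (\<Sum>I\<in>D. norm (\<xi> (Sup I) - \<xi> (Inf I))) < e"
    using assms \<open>e > 0\<close> unfolding abs_continuous_fun_on_def
    by (elim allE[of _ e]) auto
  have close: "norm (\<xi> q - \<xi> p) < e" if "p \<le> q" "a \<le> p" "q \<le> b" "q - p < d" for p q
  proof -
    have "{{p..q}} division_of \<Union>{{p..q}}"
      using that division_of_self[of p q] by (simp add: box_real)
    from small[OF this] that show ?thesis by simp
  qed
  have "dist (\<xi> s) (\<xi> t) < e" if "s \<in> {a..b}" "dist s t < d" for s
    using close[of s t] close[of t s] that t
    by (cases "s \<le> t") (auto simp: dist_norm norm_minus_commute)
  then show "\<exists>d>0. \<forall>s\<in>{a..b}. dist s t < d \<longrightarrow> dist (\<xi> s) (\<xi> t) < e"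
    using d by blast
qed

text \<open>
  Absolute continuity speaks about divisions, which are sets of intervals, while the gauge
  argument below produces tagged ones. Forgetting the tags can only identify degenerate
  intervals, and these contribute nothing to either sum.
\<close>

lemma tagged_sum_lt_of_abs_continuous:
  fixes \<xi> :: "real \<Rightarrow> 'a::real_normed_vector"
  assumes p: "p tagged_partial_division_of {a..b}"
    and short: "(\<Sum>(x, K)\<in>p. Sup K - Inf K) < d"
    and small: "\<And>D. D division_of \<Union>D \<Longrightarrow> \<Union>D \<subseteq> {a..b} \<Longrightarrow>
      (\<Sum>I\<in>D. Sup I - Inf I) < d \<Longrightarrow> (\<Sum>I\<in>D. norm (\<xi> (Sup I) - \<xi> (Inf I))) < e"
  shows "(\<Sum>(x, K)\<in>p. norm (\<xi> (Sup K) - \<xi> (Inf K))) < e"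
proof -
  have reindex: "(\<Sum>(x, K)\<in>p. g (Inf K) (Sup K)) = (\<Sum>K\<in>snd ` p. g (Inf K) (Sup K))"
    if "\<And>u. g u u = 0" for g :: "real \<Rightarrow> real \<Rightarrow> real"
  proof -
    \<comment> \<open>The case distinction forces the value 0 on the empty interval, for which \<open>Sup\<close> and \<open>Inf\<close>
      are unspecified.\<close>
    have "(\<Sum>(x, K)\<in>p. if K = {} then 0 else g (Inf K) (Sup K))
        = (\<Sum>K\<in>snd ` p. if K = {} then 0 else g (Inf K) (Sup K))"
      by (rule sum.over_tagged_division_lemma[OF tagged_partial_division_of_Union_self[OF p]])
        (use that in \<open>auto simp: box_real\<close>)
    moreover have "K \<noteq> {}" if "(x, K) \<in> p" for x K
      using tagged_partial_division_ofD(2)[OF p that] by auto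
    ultimately show ?thesis
      by (smt (verit, best) case_prodE2 imageE prod.collapse split_cong sum.cong)
  qed
  have "snd ` p division_of \<Union>(snd ` p)"
    using partial_division_of_tagged_division[OF p] .
  moreover have "\<Union>(snd ` p) \<subseteq> {a..b}"
    using tagged_partial_division_ofD(3)[OF p] by fastforce
  moreover have "(\<Sum>K\<in>snd ` p. Sup K - Inf K) < d"
    using short reindex[of "\<lambda>u v. v - u"] by simp
  ultimately show ?thesis
    using small reindex[of "\<lambda>u v. norm (\<xi> v - \<xi> u)"] by simp
qed

lemma tagged_length_le_measure:
  assumes p: "p tagged_partial_division_of {a..b::real}"
    and sub: "\<And>x K. (x, K) \<in> p \<Longrightarrow> K \<subseteq> T" and T: "T \<in> lmeasurable"
  shows "(\<Sum>(x, K)\<in>p. Sup K - Inf K) \<le> measure lebesgue T"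
proof -
  have "(\<Sum>(x, K)\<in>p. Sup K - Inf K) = (\<Sum>(x, K)\<in>p. measure lebesgue K)"
  proof (rule sum.cong, simp, clarify)
    fix x K assume "(x, K) \<in> p"
    then obtain u v where "K = cbox u v" "x \<in> K"
      using tagged_partial_division_ofD[OF p] by metis
    then show "Sup K - Inf K = measure lebesgue K" by (auto simp: box_real)
  qed
  also have "\<dots> = (\<Sum>K\<in>snd ` p. measure lebesgue K)"
    by (rule sum.over_tagged_division_lemma[OF tagged_partial_division_of_Union_self[OF p]])
      (simp add: content_eq_0_interior)
  also have "\<dots> = measure lebesgue (\<Union>(snd ` p))"
    by (rule content_division[OF partial_division_of_tagged_division[OF p]])
  also have "\<dots> \<le> measure lebesgue T"
  proof (rule measure_mono_fmeasurable[OF _ _ T])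
    show "\<Union>(snd ` p) \<subseteq> T" using sub by fastforce
    show "\<Union>(snd ` p) \<in> sets lebesgue"
      using lmeasurable_division[OF partial_division_of_tagged_division[OF p]] by blast
  qed
  finally show ?thesis .
qed

text \<open>
  The straddle estimate: comparing the values at two points on either side of \<open>t\<close> loses no more
  than comparing each of them with the value at \<open>t\<close>, since the two distances to \<open>t\<close> add up.
\<close>

lemma has_derivative_straddle:
  fixes v :: "real \<Rightarrow> real"
  assumes "(v has_real_derivative D) (at t within S)" "D \<le> -c" "e > 0"
  obtains r where "r > 0"
    "\<And>x y. x \<in> S \<inter> ball t r \<Longrightarrow> y \<in> S \<inter> ball t r \<Longrightarrow> x \<le> t \<Longrightarrow> t \<le> y \<Longrightarrow>
       v y - v x \<le> (e - c) * (y - x)"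
proof -
  obtain r where "r > 0" and r: "\<And>x. x \<in> S \<Longrightarrow> norm (x - t) < r \<Longrightarrow>
      norm (v x - v t - D * (x - t)) \<le> e * norm (x - t)"
    using assms(1,3) unfolding has_field_derivative_def has_derivative_within_alt
    by blast
  have "v y - v x \<le> (e - c) * (y - x)"
    if "x \<in> S \<inter> ball t r" "y \<in> S \<inter> ball t r" "x \<le> t" "t \<le> y" for x y
  proof -
    have "v y - v t - D * (y - t) \<le> e * (y - t)" "-(v x - v t - D * (x - t)) \<le> e * (t - x)"
      using r[of x] r[of y] that by (auto simp: dist_norm norm_minus_commute abs_le_iff)
    then have "v y - v x \<le> (e + D) * (y - x)" by (simp add: algebra_simps)
    also have "\<dots> \<le> (e - c) * (y - x)"
      using assms(2) that by (intro mult_right_mono) auto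
    finally show ?thesis .
  qed
  with \<open>r > 0\<close> show thesis using that by blast
qed

text \<open>
  An absolutely continuous function is controlled by its almost everywhere derivative. The function
  \<open>v\<close> inherits absolute continuity from \<open>\<xi>\<close> because locally it is \<open>L\<close>-Lipschitz as a function of
  \<open>\<xi>\<close>. The constant \<open>L\<close> is uniform while the neighbourhoods may shrink from point to point: this is
  the form in which the estimate is available for a Lyapunov function that has a differentiable
  extension near each point separately.

  The proof replaces the Vitali covering theorem by a gauge. Cover the exceptional null set \<open>N\<close> by
  an open set \<open>T\<close> of small measure, and let the gauge keep intervals tagged in \<open>N\<close> inside \<open>T\<close> and
  make the straddle estimate valid for all other intervals. In a tagged division that is fine for
  this gauge, intervals of the first kind have small total length, so absolute continuity bounds
  their contribution; the others contribute at most \<open>e - c\<close> times their length.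
\<close>

lemma decrease_of_AE_derivative_le:
  fixes v :: "real \<Rightarrow> real" and \<xi> :: "real \<Rightarrow> 'a::real_normed_vector"
  assumes "a \<le> b" and "L > 0"
    and ac: "abs_continuous_fun_on {a..b} \<xi>"
    and lip: "\<And>t. t \<in> {a..b} \<Longrightarrow> \<exists>d>0. \<forall>x\<in>{a..b} \<inter> ball t d. \<forall>y\<in>{a..b} \<inter> ball t d.
                \<bar>v x - v y\<bar> \<le> L * norm (\<xi> x - \<xi> y)"
    and der: "AE t in lebesgue. t \<in> {a..b} \<longrightarrow>
                (\<exists>D\<le>-c. (v has_real_derivative D) (at t within {a..b}))"
  shows "v b \<le> v a - c * (b - a)"
proof -
  have approx: "v b - v a \<le> (e - c) * (b - a) + 2 * e" if "e > 0" for e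
  proof -
    obtain d where d: "d > 0" and small: "\<And>D. D division_of \<Union>D \<Longrightarrow> \<Union>D \<subseteq> {a..b} \<Longrightarrow>
        (\<Sum>I\<in>D. Sup I - Inf I) < d \<Longrightarrow> (\<Sum>I\<in>D. norm (\<xi> (Sup I) - \<xi> (Inf I))) < e / L"
      using ac \<open>e > 0\<close> \<open>L > 0\<close> unfolding abs_continuous_fun_on_def
      by (elim allE[of _ "e / L"]) auto
    \<comment> \<open>Measure below \<open>d\<close> makes absolute continuity applicable on \<open>T\<close>; the second bound keeps the
      length lost to \<open>T\<close>, multiplied by \<open>c\<close>, at most \<open>e\<close>.\<close>
    define m where "m = min d (e / (\<bar>c\<bar> + 1))"
    have "m > 0" using d \<open>e > 0\<close> by (simp add: m_def)
    obtain N where N: "N \<in> null_sets lebesgue" and der_N: "\<And>t. t \<in> {a..b} \<Longrightarrow> t \<notin> N \<Longrightarrow>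
        \<exists>D\<le>-c. (v has_real_derivative D) (at t within {a..b})"
      using der by (elim AE_E3) (rule that, auto)
    obtain T where T: "open T" "N \<subseteq> T" "T - N \<in> lmeasurable" "emeasure lebesgue (T - N) < ennreal m"
      using sets_lebesgue_outer_open[of N m] N \<open>m > 0\<close> by (metis null_setsD2)
    have "T \<in> lmeasurable"
      using fmeasurable.Un[OF fmeasurableI_null_sets[OF N] T(3)] T(2) by (simp add: Un_absorb1)
    have "measure lebesgue T < m"
    proof -
      have "measure lebesgue T = measure lebesgue (T - N)"
        using N \<open>T \<in> lmeasurable\<close> by (simp add: measure_Diff_null_set fmeasurableD)
      also have "\<dots> < m"
        using T(3,4) \<open>m > 0\<close> by (simp add: emeasure_eq_measure2 ennreal_less_iff)
      finally show ?thesis .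
    qed
    define suits where "suits t r \<longleftrightarrow>
        (t \<in> N \<longrightarrow> ball t r \<subseteq> T \<and> (\<forall>x\<in>{a..b} \<inter> ball t r. \<forall>y\<in>{a..b} \<inter> ball t r.
           \<bar>v x - v y\<bar> \<le> L * norm (\<xi> x - \<xi> y))) \<and>
        (t \<notin> N \<longrightarrow> (\<forall>x\<in>{a..b} \<inter> ball t r. \<forall>y\<in>{a..b} \<inter> ball t r. x \<le> t \<longrightarrow> t \<le> y \<longrightarrow>
           v y - v x \<le> (e - c) * (y - x)))" for t r
    have "\<exists>r>0. t \<in> {a..b} \<longrightarrow> suits t r" for t
    proof (cases "t \<in> {a..b}")
      case t: True
      show ?thesis
      proof (cases "t \<in> N")
        case True
        obtain r1 where "r1 > 0" "ball t r1 \<subseteq> T"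
          using T True open_contains_ball by blast
        moreover obtain r2 where "r2 > 0" "\<forall>x\<in>{a..b} \<inter> ball t r2. \<forall>y\<in>{a..b} \<inter> ball t r2.
           \<bar>v x - v y\<bar> \<le> L * norm (\<xi> x - \<xi> y)"
          using lip[OF t] by auto
        ultimately show ?thesis
          using True unfolding suits_def by (intro exI[of _ "min r1 r2"]) auto
      next
        case False
        then obtain D where D: "D \<le> -c" "(v has_real_derivative D) (at t within {a..b})"
          using der_N t by blast
        obtain r where "r > 0" "\<And>x y. x \<in> {a..b} \<inter> ball t r \<Longrightarrow> y \<in> {a..b} \<inter> ball t r \<Longrightarrow>
            x \<le> t \<Longrightarrow> t \<le> y \<Longrightarrow> v y - v x \<le> (e - c) * (y - x)"
          using has_derivative_straddle[OF D(2,1) \<open>e > 0\<close>] by blast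
        then show ?thesis
          using False unfolding suits_def by blast
      qed
    qed (use zero_less_one in blast)
    then obtain r where r: "\<And>t. r t > 0" and suits: "\<And>t. t \<in> {a..b} \<Longrightarrow> suits t (r t)"
      by metis
    have null: "\<And>t. t \<in> {a..b} \<Longrightarrow> t \<in> N \<Longrightarrow> ball t (r t) \<subseteq> T"
      and rlip: "\<And>t x y. t \<in> {a..b} \<Longrightarrow> t \<in> N \<Longrightarrow> x \<in> {a..b} \<inter> ball t (r t) \<Longrightarrow>
           y \<in> {a..b} \<inter> ball t (r t) \<Longrightarrow> \<bar>v x - v y\<bar> \<le> L * norm (\<xi> x - \<xi> y)"
      and good: "\<And>t x y. t \<in> {a..b} \<Longrightarrow> t \<notin> N \<Longrightarrow> x \<in> {a..b} \<inter> ball t (r t) \<Longrightarrow>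
           y \<in> {a..b} \<inter> ball t (r t) \<Longrightarrow> x \<le> t \<Longrightarrow> t \<le> y \<Longrightarrow> v y - v x \<le> (e - c) * (y - x)"
      using suits unfolding suits_def by blast+
    have "gauge (\<lambda>t. ball t (r t))" using r by (simp add: gauge_def)
    then obtain p where p: "p tagged_division_of {a..b}" and fine: "(\<lambda>t. ball t (r t)) fine p"
      using fine_division_exists_real by blast
    have "finite p" using p by (rule tagged_division_of_finite)
    have ends: "x \<in> {a..b} \<and> Inf K \<le> x \<and> x \<le> Sup K \<and> Inf K \<in> {a..b} \<inter> ball x (r x) \<and>
        Sup K \<in> {a..b} \<inter> ball x (r x)" if xK: "(x, K) \<in> p" for x K
    proof -
      obtain u w where "K = cbox u w" "x \<in> K"
        using tagged_division_ofD(2,4)[OF p xK] by blast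
      then have "K = {u..w}" "u \<le> x" "x \<le> w" by (auto simp: box_real)
      moreover have "K \<subseteq> {a..b}" "K \<subseteq> ball x (r x)"
        using tagged_division_ofD(3)[OF p xK] fine xK by (auto simp: fine_def)
      ultimately show ?thesis by (auto simp: subset_eq)
    qed
    define q where "q = {z\<in>p. fst z \<in> N}"
    have q: "q \<subseteq> p" by (auto simp: q_def)
    then have q_part: "q tagged_partial_division_of {a..b}"
      using p tagged_partial_division_subset unfolding tagged_division_of_def by blast
    define s where "s = (\<Sum>(x, K)\<in>q. Sup K - Inf K)"
    have s_less: "s < m"
    proof -
      have "s \<le> measure lebesgue T" unfolding s_def
      proof (rule tagged_length_le_measure[OF q_part _ \<open>T \<in> lmeasurable\<close>])
        fix x K assume "(x, K) \<in> q"
        then have "(x, K) \<in> p" "x \<in> N" by (auto simp: q_def)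
        then show "K \<subseteq> T" using null[of x] ends[of x K] fine by (fastforce simp: fine_def)
      qed
      with \<open>measure lebesgue T < m\<close> show ?thesis by simp
    qed
    have "s \<ge> 0" unfolding s_def by (rule sum_nonneg) (use q ends in fastforce)
    have bad: "(\<Sum>(x, K)\<in>q. v (Sup K) - v (Inf K)) \<le> e"
    proof -
      have "(\<Sum>(x, K)\<in>q. v (Sup K) - v (Inf K)) \<le> (\<Sum>(x, K)\<in>q. L * norm (\<xi> (Sup K) - \<xi> (Inf K)))"
      proof (rule sum_mono, clarify)
        fix x K assume "(x, K) \<in> q"
        then have "(x, K) \<in> p" "x \<in> N" by (auto simp: q_def)
        then show "v (Sup K) - v (Inf K) \<le> L * norm (\<xi> (Sup K) - \<xi> (Inf K))"
          using rlip[of x "Sup K" "Inf K"] ends[of x K] by auto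
      qed
      also have "\<dots> = L * (\<Sum>(x, K)\<in>q. norm (\<xi> (Sup K) - \<xi> (Inf K)))"
        by (simp add: sum_distrib_left case_prod_beta)
      also have "\<dots> \<le> L * (e / L)"
      proof (rule mult_left_mono)
        have "(\<Sum>(x, K)\<in>q. norm (\<xi> (Sup K) - \<xi> (Inf K))) < e / L"
        proof (rule tagged_sum_lt_of_abs_continuous[OF q_part])
          show "(\<Sum>(x, K)\<in>q. Sup K - Inf K) < d" using s_less by (simp add: s_def m_def)
        qed (rule small)
        then show "(\<Sum>(x, K)\<in>q. norm (\<xi> (Sup K) - \<xi> (Inf K))) \<le> e / L" by simp
      qed (use \<open>L > 0\<close> in simp)
      finally show ?thesis using \<open>L > 0\<close> by simp
    qed
    have "(\<Sum>(x, K)\<in>p - q. v (Sup K) - v (Inf K)) \<le> (\<Sum>(x, K)\<in>p - q. (e - c) * (Sup K - Inf K))"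
    proof (rule sum_mono, clarify)
      fix x K assume "(x, K) \<in> p" "(x, K) \<notin> q"
      then have "(x, K) \<in> p" "x \<notin> N" by (auto simp: q_def)
      then show "v (Sup K) - v (Inf K) \<le> (e - c) * (Sup K - Inf K)"
        using good[of x "Inf K" "Sup K"] ends[of x K] by auto
    qed
    also have "\<dots> = (e - c) * (\<Sum>(x, K)\<in>p - q. Sup K - Inf K)"
      by (simp add: sum_distrib_left case_prod_beta)
    also have "(\<Sum>(x, K)\<in>p - q. Sup K - Inf K) = (b - a) - s"
      using sum.subset_diff[OF q \<open>finite p\<close>, of "\<lambda>(x, K). Sup K - Inf K"]
        additive_tagged_division_1[OF \<open>a \<le> b\<close> p, of "\<lambda>x. x"] by (simp add: s_def)
    finally have "v b - v a \<le> (e - c) * (b - a - s) + e"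
      using bad sum.subset_diff[OF q \<open>finite p\<close>, of "\<lambda>(x, K). v (Sup K) - v (Inf K)"]
        additive_tagged_division_1[OF \<open>a \<le> b\<close> p, of v] by simp
    moreover have "c * s \<le> e"
    proof -
      have "c * s \<le> (\<bar>c\<bar> + 1) * m"
        using s_less \<open>s \<ge> 0\<close> by (intro mult_mono) auto
      also have "\<dots> \<le> (\<bar>c\<bar> + 1) * (e / (\<bar>c\<bar> + 1))"
        by (intro mult_left_mono) (auto simp: m_def)
      finally show ?thesis by simp
    qed
    moreover have "e * s \<ge> 0" using \<open>e > 0\<close> \<open>s \<ge> 0\<close> by simp
    ultimately show ?thesis by (simp add: algebra_simps)
  qed
  have "v b - v a + c * (b - a) \<le> 0"
  proof (rule field_le_epsilon)
    fix e :: real assume "e > 0"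
    define k where "k = e / (b - a + 2)"
    have "k > 0" "e = k * (b - a + 2)" using \<open>e > 0\<close> \<open>a \<le> b\<close> by (auto simp: k_def)
    then show "v b - v a + c * (b - a) \<le> 0 + e" using approx[of k] by (simp add: algebra_simps)
  qed
  then show ?thesis by simp
qed

section \<open>Uniform decay on layers of a decrease function\<close>

text \<open>
  What remains of a decrease function at a single point \<open>x\<close> once all its estimates are made
  quantitative. The neighbourhood \<open>N\<close> and the local extension \<open>V'\<close> depend on \<open>x\<close>, whereas the decay
  rate \<open>c\<close>, the Lipschitz constant \<open>L\<close> and the set \<open>Q\<close> of input values are parameters, so that they
  can be chosen uniformly over a compact set of points.
\<close>

definition decreases_at ::
    "(real^'n \<Rightarrow> 'u \<Rightarrow> real^'n) \<Rightarrow> (real^'n) set \<Rightarrow> (real^'n \<Rightarrow> real) \<Rightarrow> real \<Rightarrow> real \<Rightarrow> 'u set \<Rightarrow>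
     real^'n \<Rightarrow> bool" where
  "decreases_at f X V c L Q x \<longleftrightarrow>
     (\<exists>N V' g. open N \<and> x \<in> N \<and> (\<forall>y\<in>N \<inter> X. V' y = V y) \<and> GDERIV V' x :> g \<and>
        (\<forall>u\<in>Q. g \<bullet> f x u \<le> - c) \<and>
        (\<forall>y\<in>N \<inter> X. \<forall>z\<in>N \<inter> X. \<bar>V y - V z\<bar> \<le> L * norm (y - z)))"

lemma decreases_at_weaken:
  assumes "decreases_at f X V c L Q x" "c' \<le> c" "L \<le> L'" "Q' \<subseteq> Q"
  shows "decreases_at f X V c' L' Q' x"
proof -
  obtain N V' g where "open N" "x \<in> N" "\<forall>y\<in>N \<inter> X. V' y = V y" "GDERIV V' x :> g"
    and g: "\<forall>u\<in>Q. g \<bullet> f x u \<le> - c"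
    and lip: "\<forall>y\<in>N \<inter> X. \<forall>z\<in>N \<inter> X. \<bar>V y - V z\<bar> \<le> L * norm (y - z)"
    using assms(1) unfolding decreases_at_def by blast
  moreover have "\<forall>u\<in>Q'. g \<bullet> f x u \<le> - c'" using g assms(2,4) by fastforce
  moreover have "\<forall>y\<in>N \<inter> X. \<forall>z\<in>N \<inter> X. \<bar>V y - V z\<bar> \<le> L' * norm (y - z)"
    using lip mult_right_mono[OF assms(3) norm_ge_zero] by (meson order_trans)
  ultimately show ?thesis unfolding decreases_at_def by blast
qed

lemma gradient_bounded_imp_lipschitz:
  fixes V :: "'a::euclidean_space \<Rightarrow> real"
  assumes "convex S" and "\<And>y. y \<in> S \<Longrightarrow> GDERIV V y :> G y" and "\<And>y. y \<in> S \<Longrightarrow> norm (G y) \<le> L"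
    and "y \<in> S" "z \<in> S"
  shows "\<bar>V y - V z\<bar> \<le> L * norm (y - z)"
proof -
  have "norm (V y - V z) \<le> L * norm (y - z)"
  proof (rule differentiable_bound[OF assms(1) _ _ assms(4,5)])
    show "(V has_derivative (\<lambda>k. k \<bullet> G x)) (at x within S)" if "x \<in> S" for x
      using assms(2)[OF that] unfolding gderiv_def by (rule has_derivative_at_withinI)
    show "onorm (\<lambda>k. k \<bullet> G x) \<le> L" if "x \<in> S" for x
    proof (rule onorm_le)
      fix k show "norm (k \<bullet> G x) \<le> L * norm k"
        using Cauchy_Schwarz_ineq2[of k "G x"] mult_right_mono[OF assms(3)[OF that] norm_ge_zero, of k]
        by (simp add: mult.commute)
    qed
  qed
  then show ?thesis by simp
qed

text \<open>
  The sign condition holds on \<open>{x} \<times> U\<close> only. As this set is compact, the derivative is bounded away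
  from 0 on it, and by Wallace's theorem the bound persists on a product of open neighbourhoods of
  \<open>x\<close> and of \<open>U\<close>. Enlarging \<open>U\<close> to an open set is what makes the estimate usable for inputs that
  merely converge to \<open>U\<close>.
\<close>

lemma decrease_function_near_point:
  fixes f :: "real^'n \<Rightarrow> 'u::metric_space \<Rightarrow> real^'n"
  assumes V: "decrease_function f X0 X U V" and "compact U"
    and f: "continuous_on (X0 \<times> UNIV) (\<lambda>(x, u). f x u)"
    and x: "x \<in> X" "V x \<noteq> 0"
  shows "\<exists>N c L Q. open N \<and> x \<in> N \<and> 0 < c \<and> 0 < L \<and> open Q \<and> U \<subseteq> Q \<and>
           (\<forall>y\<in>N \<inter> X. decreases_at f X V c L Q y)"
proof -
  obtain W V' G where W: "open W" "x \<in> W" "W \<subseteq> X0" and V': "\<forall>y\<in>W \<inter> X. V' y = V y"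
    and G: "\<forall>y\<in>W. GDERIV V' y :> G y" "continuous_on W G" "\<forall>u\<in>U. G x \<bullet> f x u < 0"
  proof -
    have "x \<in> X - zero_set X V" using x by (simp add: zero_set_def)
    with V show thesis unfolding decrease_function_def using that by blast
  qed
  define \<Phi> where "\<Phi> = (\<lambda>p. G (fst p) \<bullet> f (fst p) (snd p))"
  have \<Phi>: "continuous_on (W \<times> UNIV) \<Phi>"
  proof -
    have "continuous_on (W \<times> UNIV) (\<lambda>p. f (fst p) (snd p))"
      using continuous_on_subset[OF f, of "W \<times> UNIV"] W(3) by (auto simp: case_prod_beta)
    moreover have "continuous_on (W \<times> (UNIV :: 'u set)) (\<lambda>p. G (fst p))"
      by (rule continuous_on_compose2[OF G(2)]) (auto intro: continuous_intros)
    ultimately show ?thesis unfolding \<Phi>_def by (intro continuous_intros)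
  qed
  obtain c where "c > 0" and c: "\<forall>u\<in>U. \<Phi> (x, u) < - c"
  proof (cases "U = {}")
    case False
    have "continuous_on U (\<lambda>u. \<Phi> (x, u))"
      by (rule continuous_on_compose2[OF \<Phi>]) (use W(2) in \<open>auto intro!: continuous_intros\<close>)
    then obtain u where u: "u \<in> U" "\<forall>w\<in>U. \<Phi> (x, w) \<le> \<Phi> (x, u)"
      using continuous_attains_sup[OF \<open>compact U\<close> False] by blast
    have "\<Phi> (x, u) < 0" using G(3) u(1) by (simp add: \<Phi>_def)
    then show ?thesis using u(2) by (intro that[of "- \<Phi> (x, u) / 2"]) force+
  qed (use that[of 1] in auto)
  have op: "open ((W \<times> UNIV) \<inter> \<Phi> -` {..< - c})"
    by (rule continuous_open_preimage[OF \<Phi>]) (use W(1) in \<open>auto intro: open_Times\<close>)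
  obtain N1 Q where N1: "open N1" "x \<in> N1" and Q: "open Q" "U \<subseteq> Q"
    and sub: "N1 \<times> Q \<subseteq> (W \<times> UNIV) \<inter> \<Phi> -` {..< - c}"
  proof (rule Wallace_theorem_prod_topology)
    show "compactin euclidean {x}" "compactin euclidean U" using \<open>compact U\<close> by simp_all
    show "{x} \<times> U \<subseteq> (W \<times> UNIV) \<inter> \<Phi> -` {..< - c}" using c W(2) by auto
  qed (use op that in simp_all)
  obtain r where "r > 0" and r: "\<And>y. y \<in> ball x r \<Longrightarrow> y \<in> W \<and> norm (G y) \<le> norm (G x) + 1"
  proof -
    obtain r1 where "r1 > 0" "ball x r1 \<subseteq> W"
      using W open_contains_ball by blast
    moreover obtain r2 where "r2 > 0" "\<And>y. y \<in> W \<Longrightarrow> dist y x < r2 \<Longrightarrow> dist (G y) (G x) < 1"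
      using G(2) W(2) unfolding continuous_on_iff by (metis zero_less_one)
    moreover have "norm (G y) \<le> norm (G x) + 1" if "dist (G y) (G x) < 1" for y
      using norm_triangle_sub[of "G y" "G x"] that by (simp add: dist_norm)
    ultimately show ?thesis
      by (intro that[of "min r1 r2"]) (auto simp: dist_commute subset_eq intro!: less_imp_le)
  qed
  have "decreases_at f X V c (norm (G x) + 1) Q y" if y: "y \<in> (N1 \<inter> ball x r) \<inter> X" for y
  proof -
    have "y \<in> W" using r[of y] y by blast
    have "\<forall>y\<in>ball x r \<inter> X. V' y = V y" using V' r by blast
    moreover have "\<forall>u\<in>Q. G y \<bullet> f y u \<le> - c"
      using sub y by (force simp: \<Phi>_def)
    moreover have "\<forall>p\<in>ball x r \<inter> X. \<forall>z\<in>ball x r \<inter> X. \<bar>V p - V z\<bar> \<le> (norm (G x) + 1) * norm (p - z)"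
    proof (intro ballI)
      fix p z assume pz: "p \<in> ball x r \<inter> X" "z \<in> ball x r \<inter> X"
      have "\<bar>V' p - V' z\<bar> \<le> (norm (G x) + 1) * norm (p - z)"
        by (rule gradient_bounded_imp_lipschitz[of "ball x r" V' G]) (use pz r G(1) in auto)
      moreover have "V' p = V p" "V' z = V z" using pz r V' by auto
      ultimately show "\<bar>V p - V z\<bar> \<le> (norm (G x) + 1) * norm (p - z)" by simp
    qed
    ultimately show ?thesis
      using y G(1) \<open>y \<in> W\<close> unfolding decreases_at_def
      by (intro exI[of _ "ball x r"] exI[of _ V'] exI[of _ "G y"]) auto
  qed
  moreover have "0 < norm (G x) + 1" by (smt (verit) norm_ge_zero)
  moreover have "open (N1 \<inter> ball x r)" "x \<in> N1 \<inter> ball x r"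
    using N1 \<open>r > 0\<close> by auto
  ultimately show ?thesis using Q \<open>c > 0\<close> by blast
qed

text \<open>
  Properness makes a layer \<open>a \<le> V \<le> b\<close> with \<open>a > 0\<close> compact, so finitely many of the neighbourhoods
  from the previous lemma cover it, and the constants become uniform.
\<close>

lemma decrease_function_level_set:
  fixes f :: "real^'n \<Rightarrow> 'u::metric_space \<Rightarrow> real^'n"
  assumes V: "decrease_function f X0 X U V" and "compact U"
    and f: "continuous_on (X0 \<times> UNIV) (\<lambda>(x, u). f x u)"
    and "0 < a" "a \<le> b"
  obtains c L Q where "0 < c" "0 < L" "open Q" "U \<subseteq> Q"
    "\<And>x. x \<in> X \<Longrightarrow> a \<le> V x \<Longrightarrow> V x \<le> b \<Longrightarrow> decreases_at f X V c L Q x"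
proof -
  define S where "S = {x\<in>X. a \<le> V x \<and> V x \<le> b}"
  have "compact S" using V \<open>0 < a\<close> \<open>a \<le> b\<close> unfolding decrease_function_def S_def by simp
  have "\<forall>x\<in>S. \<exists>N c L Q. open N \<and> x \<in> N \<and> 0 < c \<and> 0 < L \<and> open Q \<and> U \<subseteq> Q \<and>
           (\<forall>y\<in>N \<inter> X. decreases_at f X V c L Q y)"
    using decrease_function_near_point[OF V \<open>compact U\<close> f] \<open>0 < a\<close> unfolding S_def by force
  then obtain N c L Q where loc: "\<forall>x\<in>S. open (N x) \<and> x \<in> N x \<and> 0 < c x \<and> (0::real) < L x \<and> open (Q x) \<and>
      U \<subseteq> Q x \<and> (\<forall>y\<in>N x \<inter> X. decreases_at f X V (c x) (L x) (Q x) y)"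
    unfolding bchoice_iff by (elim exE) (rule that)
  obtain F where F: "F \<subseteq> S" "finite F" "S \<subseteq> (\<Union>x\<in>F. N x)"
  proof (rule compactE_image[OF \<open>compact S\<close>, of S N])
    show "open (N x)" if "x \<in> S" for x using loc that by blast
    show "S \<subseteq> (\<Union>x\<in>S. N x)" using loc by blast
  qed (use that in blast)
  \<comment> \<open>The inserted 1 serves the case of an empty layer, where \<open>F\<close> is empty.\<close>
  define c0 where "c0 = Min (insert 1 (c ` F))"
  define L0 where "L0 = Max (insert 1 (L ` F))"
  show thesis
  proof
    show "0 < c0" using F loc by (auto simp: c0_def)
    have "1 \<le> L0" using F by (auto simp: L0_def)
    then show "0 < L0" by simp
    show "open (\<Inter>x\<in>F. Q x)" "U \<subseteq> (\<Inter>x\<in>F. Q x)" using F loc by auto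
    fix x assume "x \<in> X" "a \<le> V x" "V x \<le> b"
    then obtain z where z: "z \<in> F" "x \<in> N z" using F(3) by (auto simp: S_def)
    then have "decreases_at f X V (c z) (L z) (Q z) x" using loc F(1) \<open>x \<in> X\<close> by blast
    then show "decreases_at f X V c0 L0 (\<Inter>x\<in>F. Q x) x"
      by (rule decreases_at_weaken) (use z F(2) in \<open>auto simp: c0_def L0_def\<close>)
  qed
qed

text \<open>
  Solutions satisfy the differential equation, and inputs have their values in \<open>Q\<close>, only almost
  everywhere; this is why the integrated estimate needs the lemma on absolutely continuous
  functions.
\<close>

lemma decrease_along_solution:
  fixes \<xi> :: "real \<Rightarrow> real^'n"
  assumes sol: "is_solution f X0 \<omega> x0 \<xi>" and "0 \<le> s" "s \<le> t" and "0 < L"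
    and X: "\<And>\<tau>. \<tau> \<in> {s..t} \<Longrightarrow> \<xi> \<tau> \<in> X"
    and dec: "\<And>\<tau>. \<tau> \<in> {s..t} \<Longrightarrow> decreases_at f X V c L Q (\<xi> \<tau>)"
    and input: "AE \<tau> in lebesgue. s \<le> \<tau> \<longrightarrow> \<omega> \<tau> \<in> Q"
  shows "V (\<xi> t) \<le> V (\<xi> s) - c * (t - s)"
proof -
  have ac: "abs_continuous_fun_on {s..t} \<xi>"
  proof -
    have "abs_continuous_fun_on {0..t} \<xi>"
      using sol \<open>0 \<le> s\<close> \<open>s \<le> t\<close> unfolding is_solution_def by auto
    moreover have "{s..t} \<subseteq> {0..t}" using \<open>0 \<le> s\<close> by auto
    ultimately show ?thesis unfolding abs_continuous_fun_on_def by (meson order_trans)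
  qed
  have near: "\<exists>d>0. \<forall>\<sigma>\<in>{s..t} \<inter> ball \<tau> d. \<xi> \<sigma> \<in> N" if "\<tau> \<in> {s..t}" "open N" "\<xi> \<tau> \<in> N" for \<tau> N
  proof -
    obtain e where "e > 0" "ball (\<xi> \<tau>) e \<subseteq> N" using \<open>open N\<close> \<open>\<xi> \<tau> \<in> N\<close> open_contains_ball by blast
    moreover obtain d where "d > 0" "\<And>\<sigma>. \<sigma> \<in> {s..t} \<Longrightarrow> dist \<sigma> \<tau> < d \<Longrightarrow> dist (\<xi> \<sigma>) (\<xi> \<tau>) < e"
      using abs_continuous_fun_on_imp_continuous_on[OF ac] \<open>e > 0\<close> \<open>\<tau> \<in> {s..t}\<close>
      unfolding continuous_on_iff by metis
    ultimately show ?thesis by (intro exI[of _ d]) (auto simp: dist_commute subset_eq)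
  qed
  show ?thesis
  proof (rule decrease_of_AE_derivative_le[of s t L \<xi> "\<lambda>\<tau>. V (\<xi> \<tau>)" c])
    fix \<tau> assume \<tau>: "\<tau> \<in> {s..t}"
    obtain N where "open N" "\<xi> \<tau> \<in> N"
      "\<forall>y\<in>N \<inter> X. \<forall>z\<in>N \<inter> X. \<bar>V y - V z\<bar> \<le> L * norm (y - z)"
      using dec[OF \<tau>] unfolding decreases_at_def by blast
    with near[OF \<tau>] X show "\<exists>d>0. \<forall>x\<in>{s..t} \<inter> ball \<tau> d. \<forall>y\<in>{s..t} \<inter> ball \<tau> d.
        \<bar>V (\<xi> x) - V (\<xi> y)\<bar> \<le> L * norm (\<xi> x - \<xi> y)" by (metis IntD1 IntI)
  next
    have "AE \<tau> in lebesgue. \<tau> \<ge> 0 \<longrightarrow> (\<xi> has_vector_derivative f (\<xi> \<tau>) (\<omega> \<tau>)) (at \<tau>)"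
      using sol unfolding is_solution_def by blast
    then show "AE \<tau> in lebesgue. \<tau> \<in> {s..t} \<longrightarrow>
        (\<exists>D\<le>- c. ((\<lambda>\<tau>. V (\<xi> \<tau>)) has_real_derivative D) (at \<tau> within {s..t}))"
      using input
    proof eventually_elim
      case (elim \<tau>)
      show ?case
      proof
        assume \<tau>: "\<tau> \<in> {s..t}"
        obtain N V' g where N: "open N" "\<xi> \<tau> \<in> N" and V': "\<forall>y\<in>N \<inter> X. V' y = V y"
          and g: "GDERIV V' (\<xi> \<tau>) :> g" "\<forall>u\<in>Q. g \<bullet> f (\<xi> \<tau>) u \<le> - c"
          using dec[OF \<tau>] unfolding decreases_at_def by blast
        obtain d where "d > 0" and d: "\<forall>\<sigma>\<in>{s..t} \<inter> ball \<tau> d. \<xi> \<sigma> \<in> N" using near[OF \<tau> N] by blast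
        have "(\<xi> has_derivative (\<lambda>k. k *\<^sub>R f (\<xi> \<tau>) (\<omega> \<tau>))) (at \<tau> within {s..t})"
          using elim(1) \<tau> \<open>0 \<le> s\<close> unfolding has_vector_derivative_def
          by (auto intro: has_derivative_at_withinI)
        then have "((\<lambda>\<sigma>. V' (\<xi> \<sigma>)) has_derivative (\<lambda>k. (k *\<^sub>R f (\<xi> \<tau>) (\<omega> \<tau>)) \<bullet> g)) (at \<tau> within {s..t})"
          using g(1) unfolding gderiv_def by (rule has_derivative_compose)
        then have "((\<lambda>\<sigma>. V (\<xi> \<sigma>)) has_derivative (\<lambda>k. (k *\<^sub>R f (\<xi> \<tau>) (\<omega> \<tau>)) \<bullet> g)) (at \<tau> within {s..t})"
          by (rule has_derivative_transform_within[OF _ \<open>d > 0\<close> \<tau>])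
            (use d V' X in \<open>auto simp: dist_commute\<close>)
        moreover have "(\<lambda>k. (k *\<^sub>R f (\<xi> \<tau>) (\<omega> \<tau>)) \<bullet> g) = (*) (g \<bullet> f (\<xi> \<tau>) (\<omega> \<tau>))"
          by (auto simp: inner_commute)
        ultimately have "((\<lambda>\<sigma>. V (\<xi> \<sigma>)) has_real_derivative (g \<bullet> f (\<xi> \<tau>) (\<omega> \<tau>))) (at \<tau> within {s..t})"
          unfolding has_field_derivative_def by simp
        moreover have "g \<bullet> f (\<xi> \<tau>) (\<omega> \<tau>) \<le> - c" using g(2) elim(2) \<tau> by auto
        ultimately show "\<exists>D\<le>- c. ((\<lambda>\<tau>. V (\<xi> \<tau>)) has_real_derivative D) (at \<tau> within {s..t})"
          by blast
      qed
    qed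
  qed (use \<open>s \<le> t\<close> \<open>0 < L\<close> ac in auto)
qed

text \<open>
  If \<open>v q > a\<close>, consider the last time \<open>s\<close> at which \<open>v \<le> a\<close>. By continuity, \<open>v \<ge> a\<close> from \<open>s\<close> on,
  hence \<open>v q \<le> v s \<le> a\<close>. Monotonicity is demanded only where \<open>v \<ge> a\<close>, which for \<open>a > 0\<close> accommodates
  decrease functions that are not differentiable where they vanish.
\<close>

lemma stays_below_level:
  fixes v :: "real \<Rightarrow> real"
  assumes "continuous_on {p..q} v" "p \<le> q" "v p \<le> a"
    and noninc: "\<And>s. s \<in> {p..q} \<Longrightarrow> (\<And>\<tau>. \<tau> \<in> {s..q} \<Longrightarrow> a \<le> v \<tau>) \<Longrightarrow> v q \<le> v s"
  shows "v q \<le> a"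
proof (rule ccontr)
  assume above: "\<not> v q \<le> a"
  define S where "S = {\<tau>\<in>{p..q}. v \<tau> \<in> {..a}}"
  have "closed S"
    unfolding S_def using continuous_closed_preimage[OF assms(1), of "{..a}"]
    by (simp add: Int_def vimage_def)
  moreover have "bounded S" by (rule bounded_subset[of "{p..q}"]) (auto simp: S_def)
  ultimately have "compact S" using compact_eq_bounded_closed by blast
  moreover have "S \<noteq> {}" using assms(2,3) by (auto simp: S_def)
  ultimately obtain s where s: "s \<in> S" "\<And>\<tau>. \<tau> \<in> S \<Longrightarrow> \<tau> \<le> s"
    using compact_attains_sup by metis
  have "a \<le> v \<tau>" if \<tau>: "\<tau> \<in> {s..q}" for \<tau>
  proof (rule ccontr)
    assume "\<not> a \<le> v \<tau>"
    moreover have "continuous_on {\<tau>..q} v"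
      by (rule continuous_on_subset[OF assms(1)]) (use \<tau> s(1) in \<open>auto simp: S_def\<close>)
    \<comment> \<open>A value below \<open>a\<close> after \<open>s\<close> would force a later crossing of the level \<open>a\<close>.\<close>
    ultimately obtain \<sigma> where "\<tau> \<le> \<sigma>" "\<sigma> \<le> q" "v \<sigma> = a"
      using IVT'[of v \<tau> a q] above \<tau> by force
    moreover from this have "\<sigma> \<in> S" using \<tau> s(1) by (auto simp: S_def)
    ultimately have "\<sigma> = s" using s(2) \<tau> by force
    then show False using \<open>v \<sigma> = a\<close> \<open>\<not> a \<le> v \<tau>\<close> \<open>\<tau> \<le> \<sigma>\<close> \<tau> by auto
  qed
  then have "v q \<le> v s" using noninc s(1) by (auto simp: S_def)
  then show False using s(1) above by (auto simp: S_def)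
qed

section \<open>Convergence to sets and asymptotic amplitude\<close>

lemma approaches_compact_eventually_in_open:
  assumes "approaches F \<omega> U" "compact U" "open Q" "U \<subseteq> Q"
  shows "\<forall>\<^sub>F t in F. \<omega> t \<in> Q"
proof -
  obtain e where "e > 0" and e: "(\<Union>u\<in>U. cball u e) \<subseteq> Q"
    using compact_subset_open_imp_cball_epsilon_subset[OF assms(2-4)] by blast
  then have "\<forall>\<^sub>F t in F. \<exists>u\<in>U. dist (\<omega> t) u \<le> e"
    using assms(1) unfolding approaches_def by blast
  then show ?thesis by eventually_elim (use e in \<open>force simp: dist_commute subset_eq\<close>)
qed

lemma Limsup_dist_le_diameter:
  fixes p q :: "'i \<Rightarrow> 'a::metric_space"
  assumes "bounded H"
    and p: "\<And>e. e > 0 \<Longrightarrow> \<forall>\<^sub>F i in F. \<exists>z\<in>H. dist (p i) z \<le> e"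
    and q: "\<And>e. e > 0 \<Longrightarrow> \<forall>\<^sub>F i in F. \<exists>z\<in>H. dist (q i) z \<le> e"
  shows "Limsup F (\<lambda>i. ennreal (dist (p i) (q i))) \<le> ennreal (diameter H)"
proof (rule ennreal_le_epsilon)
  fix e :: real assume "e > 0"
  have "\<forall>\<^sub>F i in F. ennreal (dist (p i) (q i)) \<le> ennreal (diameter H) + ennreal e"
    using p[OF half_gt_zero[OF \<open>e > 0\<close>]] q[OF half_gt_zero[OF \<open>e > 0\<close>]]
  proof eventually_elim
    case (elim i)
    then obtain y z where "y \<in> H" "dist (p i) y \<le> e / 2" "z \<in> H" "dist (q i) z \<le> e / 2" by blast
    moreover have "dist (p i) (q i) \<le> dist (p i) y + dist y z + dist (q i) z"
      using dist_triangle[of "p i" "q i" y] dist_triangle[of y "q i" z] by (simp add: dist_commute)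
    ultimately have "dist (p i) (q i) \<le> diameter H + e"
      using diameter_bounded_bound[OF \<open>bounded H\<close>, of y z] by simp
    then show ?case
      using \<open>e > 0\<close> diameter_ge_0[OF \<open>bounded H\<close>] by (simp flip: ennreal_plus)
  qed
  then show "Limsup F (\<lambda>i. ennreal (dist (p i) (q i))) \<le> ennreal (diameter H) + ennreal e"
    by (rule Limsup_bounded)
qed

lemma asymptotic_amplitude_le_diameter:
  assumes "approaches F \<eta> H" "bounded H"
  shows "asymptotic_amplitude F \<eta> \<le> ennreal (diameter H)"
proof -
  have "\<forall>\<^sub>F i in F \<times>\<^sub>F F. \<exists>z\<in>H. dist (\<eta> (fst i)) z \<le> e" if "e > 0" for e
    unfolding eventually_prod_same using assms(1) that unfolding approaches_def by fastforce
  moreover have "\<forall>\<^sub>F i in F \<times>\<^sub>F F. \<exists>z\<in>H. dist (\<eta> (snd i)) z \<le> e" if "e > 0" for e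
    unfolding eventually_prod_same using assms(1) that unfolding approaches_def by fastforce
  ultimately show ?thesis
    using Limsup_dist_le_diameter[OF assms(2), where F = "F \<times>\<^sub>F F" and p = "\<lambda>i. \<eta> (fst i)"
        and q = "\<lambda>i. \<eta> (snd i)"]
    unfolding asymptotic_amplitude_def case_prod_beta by blast
qed

text \<open>
  The omega-limit set of \<open>\<omega>\<close>, along an arbitrary filter so that null sets of times can be
  disregarded.
\<close>

definition cluster_values :: "'i filter \<Rightarrow> ('i \<Rightarrow> 'a::metric_space) \<Rightarrow> 'a set" where
  "cluster_values F \<omega> = {u. \<forall>e>0. \<exists>\<^sub>F t in F. dist (\<omega> t) u < e}"

lemma not_cluster_value:
  assumes "u \<notin> cluster_values F \<omega>"
  obtains e where "e > 0" "\<forall>\<^sub>F t in F. \<omega> t \<notin> ball u e"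
  using assms unfolding cluster_values_def frequently_def
  by (auto simp: dist_commute)

lemma compact_cluster_values:
  assumes "compact K" and K: "\<forall>\<^sub>F t in F. \<omega> t \<in> K"
  shows "compact (cluster_values F \<omega>)"
proof -
  have "cluster_values F \<omega> \<subseteq> K"
  proof
    fix u assume u: "u \<in> cluster_values F \<omega>"
    show "u \<in> K"
    proof (rule ccontr)
      assume "u \<notin> K"
      then obtain e where "e > 0" "ball u e \<subseteq> - K"
        using compact_imp_closed[OF \<open>compact K\<close>] open_contains_ball[of "- K"] by auto
      then have "\<forall>\<^sub>F t in F. \<not> dist (\<omega> t) u < e"
        by (intro eventually_mono[OF K]) (auto simp: dist_commute subset_eq)
      then show False using u \<open>e > 0\<close> unfolding cluster_values_def frequently_def by blast
    qed
  qed
  moreover have "closed (cluster_values F \<omega>)"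
    unfolding closed_def open_contains_ball
  proof
    fix u assume "u \<in> - cluster_values F \<omega>"
    then obtain e where e: "e > 0" "\<forall>\<^sub>F t in F. \<omega> t \<notin> ball u e"
      using not_cluster_value by blast
    have "w \<notin> cluster_values F \<omega>" if "w \<in> ball u (e / 2)" for w
    proof -
      have "\<forall>\<^sub>F t in F. \<not> dist (\<omega> t) w < e / 2"
        using e(2)
      proof eventually_elim
        case (elim t)
        then show ?case using that dist_triangle_half_l[of u w e "\<omega> t"] by (auto simp: dist_commute)
      qed
      then show ?thesis using \<open>e > 0\<close> unfolding cluster_values_def frequently_def
        by (auto intro!: exI[of _ "e / 2"])
    qed
    then show "\<exists>d>0. ball u d \<subseteq> - cluster_values F \<omega>"
      using \<open>e > 0\<close> by (intro exI[of _ "e / 2"]) (auto simp del: mem_ball)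
  qed
  ultimately show ?thesis
    using compact_Int_closed[OF \<open>compact K\<close>, of "cluster_values F \<omega>"] by (simp add: Int_absorb1)
qed

text \<open>
  The points of \<open>K\<close> at distance at least \<open>e\<close> from all cluster values form a compact set. Each of them
  has a neighbourhood that \<open>\<omega>\<close> eventually leaves, and finitely many of these neighbourhoods suffice.
\<close>

lemma approaches_cluster_values:
  assumes "compact K" and K: "\<forall>\<^sub>F t in F. \<omega> t \<in> K"
  shows "approaches F \<omega> (cluster_values F \<omega>)"
  unfolding approaches_def
proof (intro allI impI)
  fix e :: real assume "e > 0"
  define far where "far = K - (\<Union>u\<in>cluster_values F \<omega>. ball u e)"
  have "compact far"
    unfolding far_def using \<open>compact K\<close> by (intro compact_diff open_UN ballI open_ball)
  have "\<forall>u\<in>far. \<exists>d. d > 0 \<and> (\<forall>\<^sub>F t in F. \<omega> t \<notin> ball u d)"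
  proof
    fix u assume "u \<in> far"
    then have "u \<notin> cluster_values F \<omega>" using \<open>e > 0\<close> by (force simp: far_def)
    then show "\<exists>d. d > 0 \<and> (\<forall>\<^sub>F t in F. \<omega> t \<notin> ball u d)" using not_cluster_value by blast
  qed
  then obtain d where d: "\<forall>u\<in>far. d u > 0 \<and> (\<forall>\<^sub>F t in F. \<omega> t \<notin> ball u (d u))"
    unfolding bchoice_iff by blast
  obtain C where C: "C \<subseteq> far" "finite C" "far \<subseteq> (\<Union>u\<in>C. ball u (d u))"
  proof (rule compactE_image[OF \<open>compact far\<close>, of far "\<lambda>u. ball u (d u)"])
    show "far \<subseteq> (\<Union>u\<in>far. ball u (d u))" using d by auto
  qed (use that in auto)
  have "\<forall>\<^sub>F t in F. \<forall>u\<in>C. \<omega> t \<notin> ball u (d u)"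
    using d C(1) by (intro eventually_ball_finite \<open>finite C\<close>) auto
  with K show "\<forall>\<^sub>F t in F. \<exists>u\<in>cluster_values F \<omega>. dist (\<omega> t) u \<le> e"
  proof eventually_elim
    case (elim t)
    then have "\<omega> t \<notin> far" using C(3) by blast
    then obtain u where "u \<in> cluster_values F \<omega>" "dist u (\<omega> t) < e"
      using elim(1) by (auto simp: far_def)
    then show ?case by (auto simp: dist_commute intro: less_imp_le)
  qed
qed

text \<open>
  Two cluster values are approximated by values of \<open>\<omega>\<close> at arbitrarily late times, and the asymptotic
  amplitude bounds the distances between the latter.
\<close>

lemma dist_cluster_values_le_amplitude:
  assumes u: "u \<in> cluster_values F \<omega>" and w: "w \<in> cluster_values F \<omega>"
  shows "ennreal (dist u w) \<le> asymptotic_amplitude F \<omega>"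
proof (rule ccontr)
  assume "\<not> ?thesis"
  then have less: "asymptotic_amplitude F \<omega> < ennreal (dist u w)" by simp
  then obtain \<alpha> where \<alpha>: "asymptotic_amplitude F \<omega> = ennreal \<alpha>" "\<alpha> \<ge> 0"
    by (cases "asymptotic_amplitude F \<omega>") auto
  define k where "k = (dist u w - \<alpha>) / 2"
  have "k > 0" "\<alpha> + 2 * k = dist u w"
    using less \<alpha> by (auto simp: k_def ennreal_less_iff field_simps)
  obtain P where P: "\<forall>\<^sub>F t in F. P t" "\<And>s t. P s \<Longrightarrow> P t \<Longrightarrow> dist (\<omega> s) (\<omega> t) < \<alpha> + k / 2"
  proof -
    have "Limsup (F \<times>\<^sub>F F) (\<lambda>(t, s). ennreal (dist (\<omega> t) (\<omega> s))) < ennreal (\<alpha> + k / 2)"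
      using \<alpha> \<open>k > 0\<close> unfolding asymptotic_amplitude_def
      by (simp add: ennreal_less_iff)
    from Limsup_lessD[OF this] show thesis
      using that \<alpha>(2) \<open>k > 0\<close> unfolding eventually_prod_same
        by (auto simp: ennreal_less_iff simp del: ennreal_plus)
  qed
  have "\<exists>t. P t \<and> dist (\<omega> t) x < k / 2" if "x \<in> cluster_values F \<omega>" for x
  proof -
    have "\<exists>\<^sub>F t in F. dist (\<omega> t) x < k / 2"
      using that half_gt_zero[OF \<open>k > 0\<close>] unfolding cluster_values_def by blast
    then have "\<exists>\<^sub>F t in F. dist (\<omega> t) x < k / 2 \<and> P t"
      using P(1) by (rule frequently_eventually_frequently)
    then show ?thesis by (auto dest: frequently_ex)
  qed
  then obtain s t where st: "P s" "dist (\<omega> s) u < k / 2" "P t" "dist (\<omega> t) w < k / 2"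
    using u w by meson
  have "dist u w \<le> dist (\<omega> s) u + dist (\<omega> s) (\<omega> t) + dist (\<omega> t) w"
    using dist_triangle[of u w "\<omega> s"] dist_triangle[of "\<omega> s" w "\<omega> t"] by (simp add: dist_commute)
  then show False using P(2)[OF st(1,3)] st(2,4) \<open>\<alpha> + 2 * k = dist u w\<close> \<open>k > 0\<close> by linarith
qed

lemma diameter_cluster_values_le:
  assumes "compact (cluster_values F \<omega>)" "asymptotic_amplitude F \<omega> \<noteq> \<infinity>"
  shows "diameter (cluster_values F \<omega>) \<le> enn2real (asymptotic_amplitude F \<omega>)"
proof (cases "cluster_values F \<omega> = {}")
  case False
  then obtain u w where "u \<in> cluster_values F \<omega>" "w \<in> cluster_values F \<omega>"
    and uw: "dist u w = diameter (cluster_values F \<omega>)"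
    using diameter_compact_attained[OF assms(1)] by blast
  then have "ennreal (dist u w) \<le> asymptotic_amplitude F \<omega>"
    using dist_cluster_values_le_amplitude by blast
  then have "enn2real (ennreal (dist u w)) \<le> enn2real (asymptotic_amplitude F \<omega>)"
    using assms(2) by (intro enn2real_mono) (auto simp: less_top)
  then show ?thesis using uw by (metis enn2real_ennreal zero_le_dist)
qed simp

text \<open>
  On the compact set of points of \<open>C\<close> whose output is at distance at least \<open>e\<close> from all outputs of
  zeros of \<open>V\<close>, the function \<open>V\<close> has a positive minimum, so \<open>\<xi>\<close> leaves that set eventually. If \<open>V\<close>
  has no zero, the set is all of \<open>C\<close> and the same argument refutes the convergence of \<open>V\<close> to 0,
  unless the filter is trivial.
\<close>

lemma approaches_image_zero_set:
  fixes h :: "real^'n \<Rightarrow> 'y::metric_space"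
  assumes "compact C" "C \<subseteq> X" and cont: "continuous_on X V" "continuous_on X h"
    and nonneg: "\<And>x. x \<in> X \<Longrightarrow> 0 \<le> V x"
    and C: "\<forall>\<^sub>F t in F. \<xi> t \<in> C" and V: "\<And>a. a > 0 \<Longrightarrow> \<forall>\<^sub>F t in F. V (\<xi> t) < a"
  shows "approaches F (\<lambda>t. h (\<xi> t)) (h ` zero_set X V)"
  unfolding approaches_def
proof (intro allI impI)
  fix e :: real assume "e > 0"
  define far where "far = {x\<in>C. \<forall>z\<in>zero_set X V. e \<le> dist (h x) (h z)}"
  have "far = C \<inter> (\<Inter>z\<in>zero_set X V. {x\<in>C. e \<le> dist (h x) (h z)})" by (auto simp: far_def)
  moreover have "closed {x\<in>C. e \<le> dist (h x) (h z)}" for z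
    using continuous_closed_preimage[of C "\<lambda>x. dist (h x) (h z)" "{e..}"]
      compact_imp_closed[OF \<open>compact C\<close>] continuous_on_subset[OF cont(2) \<open>C \<subseteq> X\<close>]
    by (simp add: Int_def vimage_def continuous_on_dist continuous_on_const)
  ultimately have "compact far"
    using \<open>compact C\<close> by (simp add: compact_Int_closed closed_INT)
  have pos: "0 < V x" if "x \<in> far" for x
  proof -
    have "x \<in> X" using that \<open>C \<subseteq> X\<close> by (auto simp: far_def)
    moreover have "x \<notin> zero_set X V" using that \<open>e > 0\<close> by (force simp: far_def)
    ultimately show ?thesis using nonneg[of x] by (simp add: zero_set_def)
  qed
  obtain a where "a > 0" and a: "\<And>x. x \<in> far \<Longrightarrow> a \<le> V x"
  proof (cases "far = {}")
    case False
    have "continuous_on far V"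
      by (rule continuous_on_subset[OF cont(1)]) (use \<open>C \<subseteq> X\<close> in \<open>auto simp: far_def\<close>)
    then obtain x where "x \<in> far" "\<And>y. y \<in> far \<Longrightarrow> V x \<le> V y"
      using continuous_attains_inf[OF \<open>compact far\<close> False] by blast
    then show ?thesis using that[of "V x"] pos by blast
  qed (use that[of 1] in simp)
  from C V[OF \<open>a > 0\<close>] show "\<forall>\<^sub>F t in F. \<exists>u\<in>h ` zero_set X V. dist (h (\<xi> t)) u \<le> e"
  proof eventually_elim
    case (elim t)
    then have "\<xi> t \<notin> far" using a[of "\<xi> t"] by force
    then show ?case using elim(1) by (force simp: far_def not_le intro: less_imp_le)
  qed
qed

section \<open>Asymptotic behaviour of solutions and gains\<close>

context control_system
begin

lemma continuous_on_along_solution: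
  assumes "admissible_input \<omega>" "x0 \<in> X" and sol: "is_solution f X0 \<omega> x0 \<xi>"
    and "continuous_on X V" "0 \<le> s"
  shows "continuous_on {s..t} (\<lambda>\<tau>. V (\<xi> \<tau>))"
proof (cases "s \<le> t")
  case True
  then have "continuous_on {0..t} \<xi>"
    using sol \<open>0 \<le> s\<close> unfolding is_solution_def
    by (auto intro: abs_continuous_fun_on_imp_continuous_on)
  then have "continuous_on {s..t} \<xi>"
    by (rule continuous_on_subset) (use \<open>0 \<le> s\<close> in auto)
  then show ?thesis
    by (rule continuous_on_compose2[OF \<open>continuous_on X V\<close>])
      (use invariant[OF assms(1-3)] \<open>0 \<le> s\<close> in auto)
qed simp

text \<open>
  For an input with values in \<open>K\<close> at almost all times, the decrease function for \<open>K\<close> cannot increase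
  along the solution. The properness of decrease functions then confines the solution to a compact set.
\<close>

lemma decrease_function_le_initial:
  assumes \<omega>: "admissible_input \<omega>" and x0: "x0 \<in> X" and sol: "is_solution f X0 \<omega> x0 \<xi>"
    and V: "decrease_function f X0 X K V" and "compact K"
    and K: "AE t in lebesgue. 0 \<le> t \<longrightarrow> \<omega> t \<in> K" and "0 \<le> t"
  shows "V (\<xi> t) \<le> V x0"
proof (rule ccontr)
  assume "\<not> ?thesis"
  then obtain a where a: "V x0 < a" "a < V (\<xi> t)" using dense by (auto simp: not_le)
  have X: "\<xi> \<tau> \<in> X" if "0 \<le> \<tau>" for \<tau> using invariant[OF \<omega> x0 sol] that by blast
  have "0 \<le> V x0" using V x0 unfolding decrease_function_def by blast
  then have "0 < a" using a by simp
  have V_cont: "continuous_on X V" using V unfolding decrease_function_def by blast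
  have cont: "continuous_on {0..t} (\<lambda>\<tau>. V (\<xi> \<tau>))"
    by (rule continuous_on_along_solution[OF \<omega> x0 sol V_cont]) simp
  \<comment> \<open>The uniform estimates need a layer bounded from above. Its top is the maximum of \<open>V\<close> over the
    finite time interval, which exists before anything is known about boundedness.\<close>
  obtain m where "m \<in> {0..t}" and m: "\<And>\<tau>. \<tau> \<in> {0..t} \<Longrightarrow> V (\<xi> \<tau>) \<le> V (\<xi> m)"
    using continuous_attains_sup[OF _ _ cont] \<open>0 \<le> t\<close> by auto
  then have "a \<le> V (\<xi> m)" using order_trans[OF less_imp_le[OF a(2)] m[of t]] \<open>0 \<le> t\<close> by simp
  then obtain c L Q where "0 < c" "0 < L" "open Q" "K \<subseteq> Q"
    and dec: "\<And>x. x \<in> X \<Longrightarrow> a \<le> V x \<Longrightarrow> V x \<le> V (\<xi> m) \<Longrightarrow> decreases_at f X V c L Q x"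
    using decrease_function_level_set[OF V \<open>compact K\<close> f_continuous \<open>0 < a\<close>] by blast
  have "V (\<xi> t) \<le> a"
  proof (rule stays_below_level[of 0 t "\<lambda>\<tau>. V (\<xi> \<tau>)", OF cont \<open>0 \<le> t\<close>])
    show "V (\<xi> 0) \<le> a" using a sol unfolding is_solution_def by simp
  next
    fix s assume s: "s \<in> {0..t}" and above: "\<And>\<tau>. \<tau> \<in> {s..t} \<Longrightarrow> a \<le> V (\<xi> \<tau>)"
    have "V (\<xi> t) \<le> V (\<xi> s) - c * (t - s)"
    proof (rule decrease_along_solution[OF sol, where X = X])
      show "AE \<tau> in lebesgue. s \<le> \<tau> \<longrightarrow> \<omega> \<tau> \<in> Q"
        using K by eventually_elim (use s \<open>K \<subseteq> Q\<close> in auto)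
    qed (use s X above m dec \<open>0 < L\<close> in auto)
    also have "\<dots> \<le> V (\<xi> s)" using s \<open>0 < c\<close> by simp
    finally show "V (\<xi> t) \<le> V (\<xi> s)" .
  qed
  then show False using a by simp
qed

text \<open>
  Inside the compact set \<open>C\<close> the function \<open>V\<close> is bounded, so the decay rate \<open>c\<close> on the layer above the
  level \<open>a\<close> is fixed before the time \<open>T\<close> after which the input is close enough to \<open>U\<close>. Boundedness of
  the solution must be known in advance: while the input is merely near \<open>U\<close>, nothing prevents \<open>V\<close> from
  increasing, and how near is near enough depends on the layer.
\<close>

lemma decrease_function_vanishes_at_infinity:
  assumes \<omega>: "admissible_input \<omega>" and x0: "x0 \<in> X" and sol: "is_solution f X0 \<omega> x0 \<xi>"
    and V: "decrease_function f X0 X U V" and "compact U"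
    and U: "approaches ess_at_top \<omega> U"
    and "compact C" "C \<subseteq> X" and C: "\<And>t. 0 \<le> t \<Longrightarrow> \<xi> t \<in> C" and "0 < e"
  shows "\<forall>\<^sub>F t in at_top. V (\<xi> t) < e"
proof -
  define a where "a = e / 2"
  have "0 < a" "a < e" using \<open>0 < e\<close> by (auto simp: a_def)
  have X: "\<xi> \<tau> \<in> X" if "0 \<le> \<tau>" for \<tau> using C \<open>C \<subseteq> X\<close> that by blast
  have V_cont: "continuous_on X V" and V_nonneg: "\<And>x. x \<in> X \<Longrightarrow> 0 \<le> V x"
    using V unfolding decrease_function_def by blast+
  obtain z where z: "z \<in> C" "\<And>x. x \<in> C \<Longrightarrow> V x \<le> V z"
    using continuous_attains_sup[OF \<open>compact C\<close> _ continuous_on_subset[OF V_cont \<open>C \<subseteq> X\<close>]] C[of 0]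
    by auto
  have "a \<le> max a (V z)" by simp
  then obtain c L Q where "0 < c" "0 < L" "open Q" "U \<subseteq> Q"
    and dec: "\<And>x. x \<in> X \<Longrightarrow> a \<le> V x \<Longrightarrow> V x \<le> max a (V z) \<Longrightarrow> decreases_at f X V c L Q x"
    using decrease_function_level_set[OF V \<open>compact U\<close> f_continuous \<open>0 < a\<close>] by blast
  obtain T where "0 \<le> T" and T: "AE t in lebesgue. T \<le> t \<longrightarrow> \<omega> t \<in> Q"
    using approaches_compact_eventually_in_open[OF U \<open>compact U\<close> \<open>open Q\<close> \<open>U \<subseteq> Q\<close>]
    unfolding eventually_ess_at_top by blast
  have decay: "V (\<xi> t) \<le> V (\<xi> s) - c * (t - s)"
    if "T \<le> s" "s \<le> t" "\<And>\<tau>. \<tau> \<in> {s..t} \<Longrightarrow> a \<le> V (\<xi> \<tau>)" for s t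
  proof (rule decrease_along_solution[OF sol])
    show "AE \<tau> in lebesgue. s \<le> \<tau> \<longrightarrow> \<omega> \<tau> \<in> Q"
      using T by eventually_elim (use \<open>T \<le> s\<close> in auto)
    show "decreases_at f X V c L Q (\<xi> \<tau>)" if "\<tau> \<in> {s..t}" for \<tau>
      using dec[of "\<xi> \<tau>"] z(2)[OF C, of \<tau>] X \<open>0 \<le> T\<close> \<open>T \<le> s\<close> that
        \<open>\<And>\<tau>. \<tau> \<in> {s..t} \<Longrightarrow> a \<le> V (\<xi> \<tau>)\<close> by auto
  qed (use X \<open>0 \<le> T\<close> \<open>0 < L\<close> that in auto)
  obtain p where "T \<le> p" "V (\<xi> p) \<le> a"
  proof (rule ccontr)
    assume "\<not> thesis"
    then have above: "a \<le> V (\<xi> \<tau>)" if "T \<le> \<tau>" for \<tau>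
      using that \<open>\<And>p. T \<le> p \<Longrightarrow> V (\<xi> p) \<le> a \<Longrightarrow> thesis\<close> by force
    \<comment> \<open>At rate \<open>c\<close> this is late enough for \<open>V\<close> to reach the value -1.\<close>
    define t where "t = T + (V (\<xi> T) + 1) / c"
    have "0 \<le> V (\<xi> T)" using V_nonneg X \<open>0 \<le> T\<close> by blast
    then have "T \<le> t" using \<open>0 < c\<close> by (simp add: t_def)
    then have "V (\<xi> t) \<le> V (\<xi> T) - c * (t - T)" using above by (intro decay) auto
    also have "\<dots> = - 1" using \<open>0 < c\<close> by (simp add: t_def)
    finally show False using V_nonneg[OF X, of t] \<open>0 \<le> T\<close> \<open>T \<le> t\<close> by simp
  qed
  have "V (\<xi> q) \<le> a" if "p \<le> q" for q
  proof (rule stays_below_level[of p q "\<lambda>\<tau>. V (\<xi> \<tau>)"])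
    show "continuous_on {p..q} (\<lambda>\<tau>. V (\<xi> \<tau>))"
      using continuous_on_along_solution[OF \<omega> x0 sol V_cont] \<open>0 \<le> T\<close> \<open>T \<le> p\<close> by auto
    fix s assume s: "s \<in> {p..q}" "\<And>\<tau>. \<tau> \<in> {s..q} \<Longrightarrow> a \<le> V (\<xi> \<tau>)"
    have "V (\<xi> q) \<le> V (\<xi> s) - c * (q - s)" using s \<open>T \<le> p\<close> by (intro decay) auto
    also have "\<dots> \<le> V (\<xi> s)" using s \<open>0 < c\<close> by simp
    finally show "V (\<xi> q) \<le> V (\<xi> s)" .
  qed (use that \<open>V (\<xi> p) \<le> a\<close> in auto)
  then show ?thesis
    unfolding eventually_at_top_linorder using \<open>a < e\<close> by (meson le_less_trans)
qed

text \<open>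
  Two decrease functions are at work: the one for a compact set \<open>K\<close> that contains the values of
  the input at almost all times keeps the solution in a compact set, and the one for \<open>U\<close> shows where
  the solution goes.
\<close>

lemma output_approaches_image_zero_set:
  assumes \<omega>\<eta>: "(\<omega>, \<eta>) \<in> system_behavior f h X0 X"
    and V: "\<And>U. compact U \<Longrightarrow> decrease_function f X0 X U (V U)"
    and "compact U" "approaches ess_at_top \<omega> U"
  shows "approaches at_top \<eta> (h ` zero_set X (V U))"
proof -
  obtain x0 \<xi> where \<omega>: "admissible_input \<omega>" and x0: "x0 \<in> X" and sol: "is_solution f X0 \<omega> x0 \<xi>"
    and \<eta>: "\<forall>t\<ge>0. \<eta> t = h (\<xi> t)"
    using \<omega>\<eta> unfolding system_behavior_def by blast
  obtain K where "compact K" and K: "AE t in lebesgue. 0 \<le> t \<longrightarrow> \<omega> t \<in> K"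
    using \<omega> unfolding admissible_input_def ess_precompact_def by blast
  have VK: "decrease_function f X0 X K (V K)" using V \<open>compact K\<close> .
  define C where "C = {x\<in>X. 0 \<le> V K x \<and> V K x \<le> V K x0}"
  have nonneg: "0 \<le> V K x" if "x \<in> X" for x using VK that unfolding decrease_function_def by blast
  then have "compact C" using VK x0 unfolding decrease_function_def C_def by simp
  have "C \<subseteq> X" by (auto simp: C_def)
  have C: "\<xi> t \<in> C" if "0 \<le> t" for t
    using decrease_function_le_initial[OF \<omega> x0 sol VK \<open>compact K\<close> K that] invariant[OF \<omega> x0 sol]
      nonneg that by (simp add: C_def)
  have "approaches at_top (\<lambda>t. h (\<xi> t)) (h ` zero_set X (V U))"
  proof (rule approaches_image_zero_set[OF \<open>compact C\<close> \<open>C \<subseteq> X\<close> _ h_continuous])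
    show "continuous_on X (V U)" "\<And>x. x \<in> X \<Longrightarrow> 0 \<le> V U x"
      using V[OF \<open>compact U\<close>] unfolding decrease_function_def by blast+
    show "\<forall>\<^sub>F t in at_top. \<xi> t \<in> C"
      using eventually_ge_at_top[of 0] by eventually_elim (rule C)
    show "\<forall>\<^sub>F t in at_top. V U (\<xi> t) < a" if "0 < a" for a
      using decrease_function_vanishes_at_infinity[OF \<omega> x0 sol V[OF \<open>compact U\<close>] \<open>compact U\<close>
          assms(4) \<open>compact C\<close> \<open>C \<subseteq> X\<close> C that] by simp
  qed
  then have near: "\<forall>\<^sub>F t in at_top. \<exists>u\<in>h ` zero_set X (V U). dist (h (\<xi> t)) u \<le> e" if "e > 0" for e
    using that unfolding approaches_def by blast
  show ?thesis
    unfolding approaches_def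
  proof (intro allI impI)
    fix e :: real assume "e > 0"
    from near[OF this] eventually_ge_at_top[of 0]
    show "\<forall>\<^sub>F t in at_top. \<exists>u\<in>h ` zero_set X (V U). dist (\<eta> t) u \<le> e"
      by eventually_elim (use \<eta> in simp)
  qed
qed

lemma bounded_image_zero_set:
  assumes "decrease_function f X0 X U V"
  shows "bounded (h ` zero_set X V)"
proof -
  have "compact {x\<in>X. 0 \<le> V x \<and> V x \<le> 0}"
    using assms unfolding decrease_function_def by blast
  moreover have "{x\<in>X. 0 \<le> V x \<and> V x \<le> 0} = zero_set X V" by (auto simp: zero_set_def)
  ultimately have "compact (zero_set X V)" by simp
  moreover have "continuous_on (zero_set X V) h"
    by (rule continuous_on_subset[OF h_continuous]) (auto simp: zero_set_def)
  ultimately show ?thesis by (intro compact_imp_bounded compact_continuous_image)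
qed

text \<open>
  The convergence statement is applied to the set of essential cluster values of the input: it is the
  smallest compact set that the input approaches, and its diameter is at most the asymptotic amplitude
  of the input. The set depends on the input, and this is where it matters that \<open>\<gamma>\<close> is the same
  for all compact sets.
\<close>

lemma cauchy_gain_of_decrease_functions:
  assumes \<gamma>: "K_infinity \<gamma>"
    and V: "\<And>U. compact U \<Longrightarrow> decrease_function f X0 X U (V U)"
    and diam: "\<And>U. compact U \<Longrightarrow> diameter (h ` zero_set X (V U)) \<le> \<gamma> (diameter U)"
  shows "cauchy_gain_on U0 \<gamma> (system_behavior f h X0 X)"
proof -
  have "asymptotic_amplitude at_top \<eta> \<le> gain_ext \<gamma> (asymptotic_amplitude ess_at_top \<omega>)"
    if \<omega>\<eta>: "(\<omega>, \<eta>) \<in> system_behavior f h X0 X" for \<omega> \<eta>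
  proof (cases "asymptotic_amplitude ess_at_top \<omega> = \<infinity>")
    case False
    let ?\<alpha> = "enn2real (asymptotic_amplitude ess_at_top \<omega>)"
    obtain K where K: "compact K" "\<forall>\<^sub>F t in ess_at_top. \<omega> t \<in> K"
      using \<omega>\<eta> unfolding system_behavior_def admissible_input_def ess_precompact_def
        eventually_ess_at_top by blast
    define \<Omega> where "\<Omega> = cluster_values ess_at_top \<omega>"
    have "compact \<Omega>" "approaches ess_at_top \<omega> \<Omega>"
      unfolding \<Omega>_def using K by (auto intro: compact_cluster_values approaches_cluster_values)
    then have "asymptotic_amplitude at_top \<eta> \<le> ennreal (diameter (h ` zero_set X (V \<Omega>)))"
      by (intro asymptotic_amplitude_le_diameter output_approaches_image_zero_set[OF \<omega>\<eta> V]
          bounded_image_zero_set[OF V])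
    also have "\<dots> \<le> ennreal (\<gamma> ?\<alpha>)"
    proof (rule ennreal_leI)
      have "diameter \<Omega> \<le> ?\<alpha>"
        unfolding \<Omega>_def using \<open>compact \<Omega>\<close> False by (intro diameter_cluster_values_le) (auto simp: \<Omega>_def)
      moreover have "0 \<le> diameter \<Omega>"
        using \<open>compact \<Omega>\<close> by (intro diameter_ge_0 compact_imp_bounded)
      ultimately have "\<gamma> (diameter \<Omega>) \<le> \<gamma> ?\<alpha>"
        using \<gamma> unfolding K_infinity_def
        by (auto intro: strict_mono_on_leD)
      then show "diameter (h ` zero_set X (V \<Omega>)) \<le> \<gamma> ?\<alpha>"
        using diam[OF \<open>compact \<Omega>\<close>] by simp
    qed
    finally show ?thesis using False by (simp add: gain_ext_def)
  qed (simp add: gain_ext_def)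
  then show ?thesis using \<gamma> unfolding cauchy_gain_on_def by blast
qed

text \<open>
  Both inputs approach the two-point set of their limits, so both outputs approach one and the same
  set, whose diameter is at most \<open>\<gamma> (dist l1 l2)\<close>.
\<close>

lemma incremental_limit_gain_of_decrease_functions:
  assumes \<gamma>: "K_infinity \<gamma>"
    and V: "\<And>U. compact U \<Longrightarrow> decrease_function f X0 X U (V U)"
    and diam: "\<And>U. compact U \<Longrightarrow> diameter (h ` zero_set X (V U)) \<le> \<gamma> (diameter U)"
  shows "incremental_limit_gain_on U0 \<gamma> (system_behavior f h X0 X)"
proof -
  have "Limsup at_top (\<lambda>t. ennreal (dist (\<eta>1 t) (\<eta>2 t))) \<le> ennreal (\<gamma> (dist l1 l2))"
    if R: "(\<omega>1, \<eta>1) \<in> system_behavior f h X0 X" "(\<omega>2, \<eta>2) \<in> system_behavior f h X0 X"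
      and lim: "(\<omega>1 \<longlongrightarrow> l1) ess_at_top" "(\<omega>2 \<longlongrightarrow> l2) ess_at_top" for \<omega>1 \<eta>1 \<omega>2 \<eta>2 l1 l2
  proof -
    let ?U = "{l1, l2}"
    let ?H = "h ` zero_set X (V ?U)"
    have "compact ?U" by simp
    have "approaches ess_at_top \<omega> ?U" if "(\<omega> \<longlongrightarrow> l) ess_at_top" "l \<in> ?U" for \<omega> l
      unfolding approaches_def
    proof (intro allI impI)
      fix e :: real assume "e > 0"
      from tendstoD[OF that(1) this] show "\<forall>\<^sub>F t in ess_at_top. \<exists>u\<in>?U. dist (\<omega> t) u \<le> e"
        by eventually_elim (use that(2) in \<open>blast intro: less_imp_le\<close>)
    qed
    then have "approaches at_top \<eta>1 ?H" "approaches at_top \<eta>2 ?H"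
      using output_approaches_image_zero_set[OF _ V \<open>compact ?U\<close>] R lim by blast+
    then have "Limsup at_top (\<lambda>t. ennreal (dist (\<eta>1 t) (\<eta>2 t))) \<le> ennreal (diameter ?H)"
      unfolding approaches_def
      by (intro Limsup_dist_le_diameter bounded_image_zero_set[OF V]) auto
    also have "diameter ?H \<le> \<gamma> (dist l1 l2)"
    proof -
      have "diameter ?U = dist l1 l2"
        unfolding diameter_def by (auto simp: dist_commute insert_Times_insert cSup_eq_Max max_def)
      then show ?thesis using diam[OF \<open>compact ?U\<close>] by simp
    qed
    finally show ?thesis by (simp add: ennreal_leI)
  qed
  then show ?thesis using \<gamma> unfolding incremental_limit_gain_on_def by blast
qed

end

theorem theorem1:
  fixes f :: "real^'n \<Rightarrow> 'u::complete_space \<Rightarrow> real^'n"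
    and h :: "real^'n \<Rightarrow> 'y::complete_space"
    and X0 X :: "(real^'n) set"
    and R :: "('u, 'y) behavior"
    and \<gamma> :: "real \<Rightarrow> real"
    and V :: "'u set \<Rightarrow> real^'n \<Rightarrow> real"
  assumes "control_system f h X0 X"
    and "R = system_behavior f h X0 X"
    and "K_infinity \<gamma>"
    and "\<And>U. compact U \<Longrightarrow> decrease_function f X0 X U (V U)"
    and "\<And>U. compact U \<Longrightarrow> diameter (h ` zero_set X (V U)) \<le> \<gamma> (diameter U)"
  shows "(\<forall>U. compact U \<longrightarrow>
            (\<forall>(\<omega>, \<eta>)\<in>R. approaches ess_at_top \<omega> U \<longrightarrow>
               approaches at_top \<eta> (h ` zero_set X (V U))) \<and>
            cauchy_gain_on U \<gamma> R \<and> incremental_limit_gain_on U \<gamma> R) \<and>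
         cauchy_gain \<gamma> R \<and> incremental_limit_gain \<gamma> R"
proof -
  interpret control_system f h X0 X by fact
  note R = \<open>R = system_behavior f h X0 X\<close>
  have "approaches at_top \<eta> (h ` zero_set X (V U))"
    if "compact U" "(\<omega>, \<eta>) \<in> R" "approaches ess_at_top \<omega> U" for U \<omega> \<eta>
    by (rule output_approaches_image_zero_set[OF that(2)[unfolded R] assms(4) that(1,3)])
  moreover have "cauchy_gain_on U \<gamma> R" for U
    unfolding R by (rule cauchy_gain_of_decrease_functions[OF assms(3-5)])
  moreover have "incremental_limit_gain_on U \<gamma> R" for U
    unfolding R by (rule incremental_limit_gain_of_decrease_functions[OF assms(3-5)])
  ultimately show ?thesis by auto
qed

end
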